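(* Let $(\mathcal X,\mathsf d,P)$ be a metric probability space. For $M,N\ge1$ let the prototype triples $V^{(1)},\dots,V^{(M)}$ be sampled independently from $P^3$ and, for each $\ell$, let the witnesses $X_{\ell1},\dots,X_{\ell N}$ be sampled independently from $P$ (independently of the prototype triples and across $\ell$). Define $$\widehat q_{\ell i}=\frac1N\sum_{m=1}^N\mathbf 1\{L_{V^{(\ell)}}(X_{\ell m})=i\},\qquad \widehat H_{M,N}=\frac1M\sum_{\ell=1}^Mh(\widehat q_\ell),\qquad \widehat q_\ell=(\widehat q_{\ell1},\widehat q_{\ell2},\widehat q_{\ell3}).$$ Then $$\widehat H_{M,N}\longrightarrow H_3(P,\mathsf d)\quad\text{in probability whenever }M,N\to\infty .$$ The same result holds for the corrected estimator $$\widehat H^{\mathrm{MM}}_{M,N}=\frac1M\sum_{\ell=1}^M\min\Bigl\{h(\widehat q_\ell)+\frac{\widehat s_\ell-1}{2N},\ \log3\Bigr\},\qquad \widehat s_\ell=\#\{i:\widehat q_{\ell i}>0\}.$$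
   Context: A metric probability space is a metric space $(\mathcal X,\mathsf d)$ with a probability measure $P$, with $\mathsf d$ measurable so that the quantities below are defined. For $v=(v_1,v_2,v_3)\in\mathcal X^3$ and $x\in\mathcal X$, $L_v(x)\in\arg\max_{1\le i\le3}\mathsf d(x,v_i)$ is the farthest-prototype label, with uniform randomization among exact ties (independently for each evaluation). For a query $X\sim P$ and a prototype triple $V=(V_1,V_2,V_3)\sim P^3$, independent, put $q_i(v)=\mathbb P\{L_V(X)=i\mid V=v\}$, $q(v)=(q_1(v),q_2(v),q_3(v))$. For a probability vector $q$ let $h(q)=-\sum_{i=1}^3q_i\log q_i$ (natural logarithm, $0\log0=0$). The farthest-cell triplet entropy is $H_3(P,\mathsf d)=\mathbb E_V\,h\{q(V)\}$. *)

theory Defs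
  imports "HOL-Probability.Probability"
begin

text \<open>Only measurability of the metric for the product of the given \<open>\<sigma>\<close>-algebra with itself is
  required; that \<open>\<sigma>\<close>-algebra need not be the Borel one and the space need not be separable.\<close>

locale metric_prob_space = prob_space P + Metric_space "space P" d
  for P :: "'a measure" and d :: "'a \<Rightarrow> 'a \<Rightarrow> real" +
  assumes measurable_metric: "(\<lambda>(x, y). d x y) \<in> borel_measurable (P \<Otimes>\<^sub>M P)"

definition triple_measure :: "'a measure \<Rightarrow> (nat \<Rightarrow> 'a) measure" where
  "triple_measure P = PiM {1..3} (\<lambda>_. P)"

definition farthest_set :: "('a \<Rightarrow> 'a \<Rightarrow> real) \<Rightarrow> (nat \<Rightarrow> 'a) \<Rightarrow> 'a \<Rightarrow> nat set" where
  "farthest_set d v x = {i. is_arg_max (\<lambda>i. d x (v i)) (\<lambda>i. i \<in> {1..3}) i}"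

text \<open>The law of the randomized label \<open>L\<^sub>v(x)\<close> for fixed \<open>v\<close> and \<open>x\<close>.\<close>

definition farthest_label :: "('a \<Rightarrow> 'a \<Rightarrow> real) \<Rightarrow> (nat \<Rightarrow> 'a) \<Rightarrow> 'a \<Rightarrow> nat pmf" where
  "farthest_label d v x = pmf_of_set (farthest_set d v x)"

text \<open>For fixed \<open>v\<close>, the bind is the law of \<open>L\<^sub>v(X)\<close> with \<open>X \<sim> P\<close>.\<close>

definition cell_prob :: "'a measure \<Rightarrow> ('a \<Rightarrow> 'a \<Rightarrow> real) \<Rightarrow> (nat \<Rightarrow> 'a) \<Rightarrow> nat \<Rightarrow> real" where
  "cell_prob P d v i = measure (P \<bind> (\<lambda>x. measure_pmf (farthest_label d v x))) {i}"

text \<open>The convention \<open>0 log 0 = 0\<close> holds because of \<open>ln 0 = 0\<close>.\<close>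

definition entropy3 :: "(nat \<Rightarrow> real) \<Rightarrow> real" where
  "entropy3 q = - (\<Sum>i\<in>{1..3}. q i * ln (q i))"

definition triplet_entropy :: "'a measure \<Rightarrow> ('a \<Rightarrow> 'a \<Rightarrow> real) \<Rightarrow> real" where
  "triplet_entropy P d = (\<integral>v. entropy3 (cell_prob P d v) \<partial>triple_measure P)"

text \<open>One sample of size \<open>M \<times> N\<close>, realized by random variables on a probability space \<open>\<Omega>\<close>:
  prototype triples \<open>V l\<close>, witnesses \<open>X l m\<close> and realized labels \<open>L l m\<close>.
  The last assumption says that ties are broken uniformly and independently for each
  evaluation: conditionally on all prototypes and witnesses, the labels are independent and
  \<open>L l m\<close> has law \<open>farthest_label d (V l) (X l m)\<close>.\<close>

definition prototypes :: "nat \<Rightarrow> (nat \<Rightarrow> 'w \<Rightarrow> nat \<Rightarrow> 'a) \<Rightarrow> 'w \<Rightarrow> nat \<Rightarrow> nat \<Rightarrow> 'a" where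
  "prototypes M V \<omega> = (\<lambda>l\<in>{1..M}. V l \<omega>)"

definition witnesses :: "nat \<Rightarrow> nat \<Rightarrow> (nat \<Rightarrow> nat \<Rightarrow> 'w \<Rightarrow> 'a) \<Rightarrow> 'w \<Rightarrow> nat \<times> nat \<Rightarrow> 'a" where
  "witnesses M N X \<omega> = (\<lambda>(l, m)\<in>{1..M} \<times> {1..N}. X l m \<omega>)"

definition prototype_algebra ::
  "'a measure \<Rightarrow> nat \<Rightarrow> 'w measure \<Rightarrow> (nat \<Rightarrow> 'w \<Rightarrow> nat \<Rightarrow> 'a) \<Rightarrow> 'w measure" where
  "prototype_algebra P M \<Omega> V =
     vimage_algebra (space \<Omega>) (prototypes M V) (PiM {1..M} (\<lambda>_. triple_measure P))"

definition witness_algebra ::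
  "'a measure \<Rightarrow> nat \<Rightarrow> nat \<Rightarrow> 'w measure \<Rightarrow> (nat \<Rightarrow> nat \<Rightarrow> 'w \<Rightarrow> 'a) \<Rightarrow> 'w measure" where
  "witness_algebra P M N \<Omega> X =
     vimage_algebra (space \<Omega>) (witnesses M N X) (PiM ({1..M} \<times> {1..N}) (\<lambda>_. P))"

definition data_algebra ::
  "'a measure \<Rightarrow> nat \<Rightarrow> nat \<Rightarrow> 'w measure \<Rightarrow> (nat \<Rightarrow> 'w \<Rightarrow> nat \<Rightarrow> 'a)
    \<Rightarrow> (nat \<Rightarrow> nat \<Rightarrow> 'w \<Rightarrow> 'a) \<Rightarrow> 'w measure" where
  "data_algebra P M N \<Omega> V X =
     vimage_algebra (space \<Omega>) (\<lambda>\<omega>. (prototypes M V \<omega>, witnesses M N X \<omega>))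
       (PiM {1..M} (\<lambda>_. triple_measure P) \<Otimes>\<^sub>M PiM ({1..M} \<times> {1..N}) (\<lambda>_. P))"

locale triplet_sample = prob_space \<Omega>
  for P :: "'a measure" and d :: "'a \<Rightarrow> 'a \<Rightarrow> real" and M N :: nat
    and \<Omega> :: "'w measure"
    and V :: "nat \<Rightarrow> 'w \<Rightarrow> nat \<Rightarrow> 'a" and X :: "nat \<Rightarrow> nat \<Rightarrow> 'w \<Rightarrow> 'a"
    and L :: "nat \<Rightarrow> nat \<Rightarrow> 'w \<Rightarrow> nat" +
  assumes prototypes_indep: "indep_vars (\<lambda>_. triple_measure P) V {1..M}"
    and prototypes_law: "\<And>l. l \<in> {1..M} \<Longrightarrow> distr \<Omega> (triple_measure P) (V l) = triple_measure P"
    and witnesses_indep: "indep_vars (\<lambda>_. P) (\<lambda>(l, m). X l m) ({1..M} \<times> {1..N})"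
    and witnesses_law: "\<And>l m. l \<in> {1..M} \<Longrightarrow> m \<in> {1..N} \<Longrightarrow> distr \<Omega> P (X l m) = P"
    and prototypes_witnesses_indep:
      "indep_set (sets (prototype_algebra P M \<Omega> V)) (sets (witness_algebra P M N \<Omega> X))"
    and labels_measurable:
      "\<And>l m. l \<in> {1..M} \<Longrightarrow> m \<in> {1..N} \<Longrightarrow> L l m \<in> measurable \<Omega> (count_space UNIV)"
    and labels_law:
      "\<And>a :: nat \<Rightarrow> nat \<Rightarrow> nat. AE \<omega> in \<Omega>.
         real_cond_exp \<Omega> (data_algebra P M N \<Omega> V X)
           (indicator {\<omega>' \<in> space \<Omega>. \<forall>l\<in>{1..M}. \<forall>m\<in>{1..N}. L l m \<omega>' = a l m}) \<omega>
         = (\<Prod>l\<in>{1..M}. \<Prod>m\<in>{1..N}. pmf (farthest_label d (V l \<omega>) (X l m \<omega>)) (a l m))"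

definition label_freq :: "nat \<Rightarrow> (nat \<Rightarrow> nat) \<Rightarrow> nat \<Rightarrow> real" where
  "label_freq N y i = 1 / real N * (\<Sum>m\<in>{1..N}. of_bool (y m = i))"

definition entropy_estimator :: "nat \<Rightarrow> nat \<Rightarrow> (nat \<Rightarrow> nat \<Rightarrow> nat) \<Rightarrow> real" where
  "entropy_estimator M N y = 1 / real M * (\<Sum>l\<in>{1..M}. entropy3 (label_freq N (y l)))"

definition support_size :: "nat \<Rightarrow> (nat \<Rightarrow> nat) \<Rightarrow> nat" where
  "support_size N y = card {i \<in> {1..3}. label_freq N y i > 0}"

definition corrected_entropy_estimator :: "nat \<Rightarrow> nat \<Rightarrow> (nat \<Rightarrow> nat \<Rightarrow> nat) \<Rightarrow> real" where
  "corrected_entropy_estimator M N y = 1 / real M * (\<Sum>l\<in>{1..M}.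
     min (entropy3 (label_freq N (y l)) + (real (support_size N (y l)) - 1) / (2 * real N)) (ln 3))"

text \<open>The underlying probability space may vary along the filter.\<close>

definition tendsto_in_prob ::
  "('i \<Rightarrow> 'w measure) \<Rightarrow> ('i \<Rightarrow> 'w \<Rightarrow> real) \<Rightarrow> real \<Rightarrow> 'i filter \<Rightarrow> bool" where
  "tendsto_in_prob \<Omega> Y c F \<longleftrightarrow>
     (\<forall>\<epsilon>>0. ((\<lambda>i. measure (\<Omega> i) {\<omega> \<in> space (\<Omega> i). \<bar>Y i \<omega> - c\<bar> > \<epsilon>}) \<longlongrightarrow> 0) F)"

end

theory Submission
  imports Defs
begin

text \<open>
  Both estimators are means over \<open>l\<close> of quantities close to the entropy of the cell vector
  \<open>q(V l)\<close>, and two independent sources of error must be shown to vanish.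

  The inner error is that of the label frequencies. Given the prototype triple \<open>V l\<close>, the labels
  of the \<open>N\<close> evaluations are independent with law \<open>q(V l)\<close>, so each frequency has mean square
  error at most \<open>1/N\<close>, uniformly in \<open>l\<close> and \<open>M\<close>. This passes through the entropy because
  \<open>x ln x\<close> is uniformly continuous and bounded by 1 in absolute value on \<open>[0,1]\<close>: for every
  \<open>\<eta> > 0\<close> there is a \<open>K\<close> such that two entropies differ by at most \<open>\<eta>\<close> plus \<open>K\<close> times the squared
  distance of the vectors (\<open>entropy3_modulus\<close>). The entropy is not Lipschitz at the boundary of
  the simplex, and this form of uniform continuity is what turns a bound on second moments
  directly into a bound on expected entropy errors.

  The outer error is that of the mean of the \<open>M\<close> independent bounded variables
  \<open>entropy3 (cell_prob P d (V l \<omega>))\<close>, whose expectation is \<open>triplet_entropy P d\<close>; its mean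
  square is at most \<open>(ln 3)\<^sup>2 / M\<close>.

  The correction changes nothing in the limit: the added term is at most \<open>1/N\<close> in absolute value,
  and truncation at \<open>ln 3\<close> can only reduce the distance to an entropy that is itself at most
  \<open>ln 3\<close> (\<open>corrected_entropy_perturbation\<close>).

  Both mean squares rest on one fact: the mean of \<open>n\<close> pairwise orthogonal variables bounded by
  \<open>B\<close> has mean square at most \<open>B\<^sup>2 / n\<close> (\<open>mean_square_of_orthogonal_mean\<close>). Orthogonality
  of the centred labels (\<open>centred_labels_orthogonal\<close>) is the probabilistic core. The conditional
  law given all prototypes and witnesses replaces the two label indicators by the tie-breaking
  probabilities at the two witnesses; prototype and witnesses being independent, Fubini's theorem
  then makes the integral factor into two integrals over one witness each, and both vanish by the
  definition of \<open>cell_prob\<close>.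
  Markov's inequality turns the bound on the expectation into one on the probability
  (\<open>entropy_mean_tail_bound\<close>), in which \<open>M\<close> and \<open>N\<close> may tend to infinity at any relative speed.
\<close>

section \<open>Continuity and range of the entropy\<close>

lemma continuous_on_x_ln_x: "continuous_on {0..} (\<lambda>x::real. x * ln x)"
proof -
  have "((\<lambda>x. x * ln x) \<longlongrightarrow> 0) (at_right (0::real))"
    by real_asymp
  then have "continuous (at x within {0..}) (\<lambda>x::real. x * ln x)" if "x \<ge> 0" for x
    using that
    by (cases "x = 0")
      (auto simp: continuous_within at_within_Ici_at_right intro!: tendsto_intros)
  then show ?thesis
    by (simp add: continuous_on_eq_continuous_within)
qed

lemma x_ln_x_bounds:
  fixes x :: real
  assumes "0 \<le> x" "x \<le> 1"
  shows "- 1 \<le> x * ln x" "x * ln x \<le> 0"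
proof -
  show "x * ln x \<le> 0"
    using assms by (cases "x = 0") (auto intro: mult_nonneg_nonpos)
  show "- 1 \<le> x * ln x"
  proof (cases "x = 0")
    case False
    then have "0 < x" using assms by simp
    then have "ln (1 / x) \<le> 1 / x - 1" by (intro ln_le_minus_one) simp
    then have "x * (- ln x) \<le> x * (1 / x - 1)"
      using \<open>0 < x\<close> by (intro mult_left_mono) (auto simp: ln_div)
    then show ?thesis using \<open>0 < x\<close> by (simp add: algebra_simps)
  qed simp
qed

text \<open>Uniform continuity gives \<open>\<epsilon>\<close> for points closer than some \<open>\<delta>\<close>; farther points satisfy
  \<open>1 \<le> (x - y)\<^sup>2 / \<delta>\<^sup>2\<close>, and both values lie in \<open>[-1,0]\<close>. A quadratic penalty is chosen because
  its expectation is a mean square error.\<close>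

lemma x_ln_x_modulus:
  assumes "\<epsilon> > (0::real)"
  obtains K where "K \<ge> 0" and
    "\<And>x y. \<lbrakk>x \<in> {0..1}; y \<in> {0..1}\<rbrakk> \<Longrightarrow> \<bar>x * ln x - y * ln y\<bar> \<le> \<epsilon> + K * (x - y)\<^sup>2"
proof -
  have "uniformly_continuous_on {0..1} (\<lambda>x::real. x * ln x)"
    by (intro compact_uniformly_continuous continuous_on_subset[OF continuous_on_x_ln_x]) auto
  then obtain \<delta> where \<delta>: "\<delta> > 0"
    "\<forall>x\<in>{0..1::real}. \<forall>y\<in>{0..1}. dist y x < \<delta> \<longrightarrow> dist (y * ln y) (x * ln x) < \<epsilon>"
    using assms unfolding uniformly_continuous_on_def by blast
  show thesis
  proof
    show "0 \<le> 1 / \<delta>\<^sup>2" by simp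
    fix x y :: real assume xy: "x \<in> {0..1}" "y \<in> {0..1}"
    show "\<bar>x * ln x - y * ln y\<bar> \<le> \<epsilon> + 1 / \<delta>\<^sup>2 * (x - y)\<^sup>2"
    proof (cases "dist x y < \<delta>")
      case True
      have "\<bar>x * ln x - y * ln y\<bar> < \<epsilon>"
        using \<delta>(2) xy True by (simp add: dist_real_def)
      moreover have "0 \<le> 1 / \<delta>\<^sup>2 * (x - y)\<^sup>2" by simp
      ultimately show ?thesis by linarith
    next
      case False
      then have "\<delta>\<^sup>2 \<le> (x - y)\<^sup>2"
        using \<open>\<delta> > 0\<close> by (simp add: dist_real_def abs_le_square_iff[symmetric])
      then have "1 \<le> 1 / \<delta>\<^sup>2 * (x - y)\<^sup>2"
        using \<open>\<delta> > 0\<close> by (simp add: field_simps)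
      moreover have "\<bar>x * ln x - y * ln y\<bar> \<le> 1"
        using x_ln_x_bounds[of x] x_ln_x_bounds[of y] xy by auto
      ultimately show ?thesis using assms by linarith
    qed
  qed
qed

lemma entropy3_modulus:
  assumes "\<epsilon> > 0"
  obtains K where "K \<ge> 0" and
    "\<And>p q. \<lbrakk>p \<in> {1..3} \<rightarrow> {0..1}; q \<in> {1..3} \<rightarrow> {0..1}\<rbrakk> \<Longrightarrow>
      \<bar>entropy3 p - entropy3 q\<bar> \<le> \<epsilon> + K * (\<Sum>i\<in>{1..3}. (p i - q i)\<^sup>2)"
proof -
  obtain K where K: "K \<ge> 0"
    "\<And>x y. \<lbrakk>x \<in> {0..1}; y \<in> {0..1}\<rbrakk> \<Longrightarrow> \<bar>x * ln x - y * ln y\<bar> \<le> \<epsilon> / 3 + K * (x - y)\<^sup>2"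
    using x_ln_x_modulus[of "\<epsilon> / 3"] assms by auto
  show thesis
  proof
    fix p q :: "nat \<Rightarrow> real" assume pq: "p \<in> {1..3} \<rightarrow> {0..1}" "q \<in> {1..3} \<rightarrow> {0..1}"
    have "\<bar>entropy3 p - entropy3 q\<bar> = \<bar>\<Sum>i\<in>{1..3}. (p i * ln (p i) - q i * ln (q i))\<bar>"
      by (simp add: entropy3_def sum_subtractf)
    also have "\<dots> \<le> (\<Sum>i\<in>{1..3::nat}. \<epsilon> / 3 + K * (p i - q i)\<^sup>2)"
      by (rule order_trans[OF sum_abs sum_mono]) (rule K(2)[OF Pi_mem[OF pq(1)] Pi_mem[OF pq(2)]])
    also have "\<dots> = \<epsilon> + K * (\<Sum>i\<in>{1..3}. (p i - q i)\<^sup>2)"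
      by (simp add: sum.distrib sum_distrib_left)
    finally show "\<bar>entropy3 p - entropy3 q\<bar> \<le> \<epsilon> + K * (\<Sum>i\<in>{1..3}. (p i - q i)\<^sup>2)" .
  qed (rule K)
qed

text \<open>The upper bound is Gibbs' inequality against the uniform distribution: \<open>ln t \<le> t - 1\<close> at
  \<open>t = 1 / (3 * q i)\<close>, weighted by \<open>q i\<close> and summed.\<close>

lemma entropy3_bounds:
  assumes q: "\<And>i. i \<in> {1..3} \<Longrightarrow> 0 \<le> q i" "(\<Sum>i\<in>{1..3}. q i) = 1"
  shows "0 \<le> entropy3 q" "entropy3 q \<le> ln 3"
proof -
  have le1: "q i \<le> 1" if "i \<in> {1..3}" for i
    using member_le_sum[of i "{1..3}" q] that q by simp
  show "0 \<le> entropy3 q"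
    unfolding entropy3_def neg_0_le_iff_le
    by (intro sum_nonpos x_ln_x_bounds(2) q(1) le1)
  have "- (q i * ln (q i)) \<le> q i * ln 3 + (1 / 3 - q i)" if i: "i \<in> {1..3}" for i
  proof (cases "q i = 0")
    case False
    then have pos: "0 < q i" using q(1)[OF i] by simp
    then have "ln (1 / (3 * q i)) \<le> 1 / (3 * q i) - 1" by (intro ln_le_minus_one) simp
    then have "q i * (- ln 3 - ln (q i)) \<le> q i * (1 / (3 * q i) - 1)"
      using pos by (intro mult_left_mono) (auto simp: ln_div ln_mult)
    then show ?thesis using pos by (simp add: algebra_simps)
  qed simp
  then have "entropy3 q \<le> (\<Sum>i\<in>{1..3}. q i * ln 3 + (1 / 3 - q i))"
    unfolding entropy3_def sum_negf[symmetric] by (rule sum_mono)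
  also have "\<dots> = ln 3"
    using q(2) by (simp add: sum.distrib sum_subtractf sum_distrib_right[symmetric])
  finally show "entropy3 q \<le> ln 3" .
qed

lemma label_freq_in_unit_interval: "label_freq N y i \<in> {0..1}"
proof -
  have "(\<Sum>m\<in>{1..N}. of_bool (y m = i) :: real) \<le> real (card {1..N}) * 1"
    by (rule sum_bounded_above) simp
  then show ?thesis
    by (auto simp: label_freq_def sum_nonneg divide_le_eq)
qed

section \<open>Means of orthogonal variables and independent pairs\<close>

text \<open>In the square of the sum, only the \<open>n\<close> diagonal terms survive, against a normalization of
  \<open>1 / n\<^sup>2\<close>.\<close>

lemma (in prob_space) mean_square_of_orthogonal_mean:
  fixes Z :: "nat \<Rightarrow> 'a \<Rightarrow> real"
  assumes n: "n \<ge> 1"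
    and meas: "\<And>a. a \<in> {1..n} \<Longrightarrow> Z a \<in> borel_measurable M"
    and bound: "\<And>a \<omega>. \<lbrakk>a \<in> {1..n}; \<omega> \<in> space M\<rbrakk> \<Longrightarrow> \<bar>Z a \<omega>\<bar> \<le> B"
    and orth: "\<And>a b. \<lbrakk>a \<in> {1..n}; b \<in> {1..n}; a \<noteq> b\<rbrakk> \<Longrightarrow> expectation (\<lambda>\<omega>. Z a \<omega> * Z b \<omega>) = 0"
  shows "integrable M (\<lambda>\<omega>. (1 / real n * (\<Sum>a\<in>{1..n}. Z a \<omega>))\<^sup>2)"
    and "expectation (\<lambda>\<omega>. (1 / real n * (\<Sum>a\<in>{1..n}. Z a \<omega>))\<^sup>2) \<le> B\<^sup>2 / real n"
proof -
  have le: "\<bar>Z a \<omega> * Z b \<omega>\<bar> \<le> B\<^sup>2" if "a \<in> {1..n}" "b \<in> {1..n}" "\<omega> \<in> space M" for a b \<omega>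
    unfolding abs_mult power2_eq_square
    using bound[OF that(1,3)] bound[OF that(2,3)] by (intro mult_mono) auto
  have int: "integrable M (\<lambda>\<omega>. Z a \<omega> * Z b \<omega>)" if "a \<in> {1..n}" "b \<in> {1..n}" for a b
    using le that meas
    by (intro integrable_const_bound[where B = "B\<^sup>2"]) (auto intro!: AE_I2 borel_measurable_times)
  have eq: "(1 / real n * (\<Sum>a\<in>{1..n}. Z a \<omega>))\<^sup>2
      = 1 / (real n)\<^sup>2 * (\<Sum>a\<in>{1..n}. \<Sum>b\<in>{1..n}. Z a \<omega> * Z b \<omega>)" for \<omega>
    by (simp add: power2_eq_square sum_product)
  show "integrable M (\<lambda>\<omega>. (1 / real n * (\<Sum>a\<in>{1..n}. Z a \<omega>))\<^sup>2)"
    unfolding eq using int by (intro integrable_mult_right Bochner_Integration.integrable_sum) auto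
  have "expectation (\<lambda>\<omega>. (1 / real n * (\<Sum>a\<in>{1..n}. Z a \<omega>))\<^sup>2)
      = 1 / (real n)\<^sup>2 * (\<Sum>a\<in>{1..n}. \<Sum>b\<in>{1..n}. expectation (\<lambda>\<omega>. Z a \<omega> * Z b \<omega>))"
  proof -
    have "expectation (\<lambda>\<omega>. \<Sum>a\<in>{1..n}. \<Sum>b\<in>{1..n}. Z a \<omega> * Z b \<omega>)
        = (\<Sum>a\<in>{1..n}. expectation (\<lambda>\<omega>. \<Sum>b\<in>{1..n}. Z a \<omega> * Z b \<omega>))"
      by (intro Bochner_Integration.integral_sum Bochner_Integration.integrable_sum int)
    also have "\<dots> = (\<Sum>a\<in>{1..n}. \<Sum>b\<in>{1..n}. expectation (\<lambda>\<omega>. Z a \<omega> * Z b \<omega>))"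
      by (intro sum.cong refl Bochner_Integration.integral_sum int)
    finally show ?thesis
      unfolding eq integral_mult_right_zero by (rule arg_cong)
  qed
  also have "\<dots> = 1 / (real n)\<^sup>2 * (\<Sum>a\<in>{1..n}. \<Sum>b\<in>{1..n}.
      if b = a then expectation (\<lambda>\<omega>. Z a \<omega> * Z a \<omega>) else 0)"
    using orth by (intro arg_cong2[where f = "(*)"] sum.cong refl) auto
  also have "\<dots> = 1 / (real n)\<^sup>2 * (\<Sum>a\<in>{1..n}. expectation (\<lambda>\<omega>. Z a \<omega> * Z a \<omega>))"
    by simp
  also have "\<dots> \<le> 1 / (real n)\<^sup>2 * (\<Sum>a\<in>{1..n}. B\<^sup>2)"
  proof (intro mult_left_mono sum_mono)
    fix a assume a: "a \<in> {1..n}"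
    show "expectation (\<lambda>\<omega>. Z a \<omega> * Z a \<omega>) \<le> B\<^sup>2"
      using int[OF a a] by (rule integral_le_const) (use le[OF a a] in \<open>auto intro!: AE_I2\<close>)
  qed simp
  also have "\<dots> = B\<^sup>2 / real n"
    using n by (simp add: power2_eq_square field_simps)
  finally show "expectation (\<lambda>\<omega>. (1 / real n * (\<Sum>a\<in>{1..n}. Z a \<omega>))\<^sup>2) \<le> B\<^sup>2 / real n" .
qed

lemma (in prob_space) indep_var_of_indep_vars:
  assumes "indep_vars M' X I" "i \<in> I" "j \<in> I" "i \<noteq> j"
  shows "indep_var (M' i) (X i) (M' j) (X j)"
proof -
  have "indep_var (M' i) ((\<lambda>f. f i) \<circ> (\<lambda>\<omega>. restrict (\<lambda>k. X k \<omega>) {i}))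
      (M' j) ((\<lambda>f. f j) \<circ> (\<lambda>\<omega>. restrict (\<lambda>k. X k \<omega>) {j}))"
    using assms
    by (intro indep_var_compose[OF indep_var_restrict[OF assms(1)]] measurable_component_singleton) auto
  then show ?thesis
    by (simp add: comp_def)
qed

text \<open>Independence is taken between \<open>\<sigma>\<close>-algebras because \<open>X\<close> and \<open>Y\<close> will have values of different
  types: a prototype triple and a pair of witnesses.\<close>

lemma (in prob_space) distr_pair_of_indep_set:
  assumes indep: "indep_set (sets F) (sets G)" and spaces: "space F = space M" "space G = space M"
    and X: "X \<in> measurable F S" and Y: "Y \<in> measurable G T"
  shows "distr M (S \<Otimes>\<^sub>M T) (\<lambda>\<omega>. (X \<omega>, Y \<omega>)) = distr M S X \<Otimes>\<^sub>M distr M T Y"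
proof -
  have sub: "subalgebra M F" "subalgebra M G"
    using indep_setD_ev1[OF indep] indep_setD_ev2[OF indep] spaces by (auto simp: subalgebra_def)
  have X': "X \<in> measurable M S" and Y': "Y \<in> measurable M T"
    using measurable_from_subalg[OF sub(1) X] measurable_from_subalg[OF sub(2) Y] .
  interpret X: prob_space "distr M S X" by (rule prob_space_distr[OF X'])
  interpret Y: prob_space "distr M T Y" by (rule prob_space_distr[OF Y'])
  show ?thesis
  proof (rule pair_measure_eqI[symmetric])
    fix A B assume "A \<in> sets (distr M S X)" "B \<in> sets (distr M T Y)"
    then have A: "A \<in> sets S" and B: "B \<in> sets T" by simp_all
    have "prob ((X -` A \<inter> space M) \<inter> (Y -` B \<inter> space M)) = prob (X -` A \<inter> space M) * prob (Y -` B \<inter> space M)"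
      using measurable_sets[OF X A] measurable_sets[OF Y B] spaces
      by (intro indep_setD[OF indep]) simp_all
    moreover have "(\<lambda>\<omega>. (X \<omega>, Y \<omega>)) -` (A \<times> B) \<inter> space M = (X -` A \<inter> space M) \<inter> (Y -` B \<inter> space M)"
      by auto
    ultimately show "emeasure (distr M S X) A * emeasure (distr M T Y) B
        = emeasure (distr M (S \<Otimes>\<^sub>M T) (\<lambda>\<omega>. (X \<omega>, Y \<omega>))) (A \<times> B)"
      using A B X' Y' by (simp add: emeasure_distr emeasure_eq_measure ennreal_mult[symmetric])
  qed (simp_all add: X.sigma_finite_measure_axioms Y.sigma_finite_measure_axioms cong: sets_pair_measure_cong)
qed

section \<open>The farthest-prototype label and its cell probabilities\<close>

lemma mem_farthest_set_iff:
  "i \<in> farthest_set d v x \<longleftrightarrow> i \<in> {1..3} \<and> (\<forall>j\<in>{1..3}. d x (v j) \<le> d x (v i))"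
  by (auto simp: farthest_set_def is_arg_max_def not_less)

lemma farthest_set_subset: "farthest_set d v x \<subseteq> {1..3}"
  by (auto simp: mem_farthest_set_iff)

lemma finite_farthest_set: "finite (farthest_set d v x)"
  by (rule finite_subset[OF farthest_set_subset]) simp

lemma farthest_set_nonempty: "farthest_set d v x \<noteq> {}"
proof -
  have "Max ((\<lambda>i. d x (v i)) ` {1..3::nat}) \<in> (\<lambda>i. d x (v i)) ` {1..3}"
    by (rule Max_in) auto
  then obtain i where i: "i \<in> {1..3}" "Max ((\<lambda>i. d x (v i)) ` {1..3::nat}) = d x (v i)"
    by (rule imageE)
  have "d x (v j) \<le> d x (v i)" if "j \<in> {1..3}" for j
    unfolding i(2)[symmetric] using that by (intro Max_ge imageI) auto
  then have "i \<in> farthest_set d v x"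
    unfolding mem_farthest_set_iff using i(1) by blast
  then show ?thesis by auto
qed

lemma set_pmf_farthest_label: "set_pmf (farthest_label d v x) \<subseteq> {1..3}"
  unfolding farthest_label_def
  using farthest_set_subset set_pmf_of_set[OF farthest_set_nonempty finite_farthest_set] by fast

lemma sum_pmf_farthest_label: "(\<Sum>i\<in>{1..3}. pmf (farthest_label d v x) i) = 1"
  by (rule sum_pmf_eq_1[OF _ set_pmf_farthest_label]) simp

context metric_prob_space
begin

lemma prob_space_triple_measure: "prob_space (triple_measure P)"
  unfolding triple_measure_def by (intro prob_space_PiM prob_space_axioms)

lemma measurable_prototype: "i \<in> {1..3} \<Longrightarrow> (\<lambda>v. v i) \<in> measurable (triple_measure P) P"
  unfolding triple_measure_def by (rule measurable_component_singleton)

lemma measurable_distance_to_prototype: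
  assumes "i \<in> {1..3}"
  shows "(\<lambda>(v, x). d x (v i)) \<in> borel_measurable (triple_measure P \<Otimes>\<^sub>M P)"
proof -
  have "(\<lambda>z. (snd z, fst z i)) \<in> measurable (triple_measure P \<Otimes>\<^sub>M P) (P \<Otimes>\<^sub>M P)"
    by (intro measurable_Pair measurable_snd measurable_compose[OF measurable_fst]
        measurable_prototype assms)
  from measurable_compose[OF this measurable_metric] show ?thesis
    by (simp add: case_prod_beta)
qed

text \<open>The set of maximizers takes finitely many values, and each value is described by finitely many
  comparisons between distances. Hence every function of this set is measurable too, in particular
  the law of the label.\<close>

lemma measurable_farthest_set:
  "(\<lambda>(v, x). farthest_set d v x) \<in> measurable (triple_measure P \<Otimes>\<^sub>M P) (count_space UNIV)"
proof -
  let ?S = "triple_measure P \<Otimes>\<^sub>M P"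
  have *: "(\<lambda>z. d (snd z) (fst z i)) \<in> borel_measurable ?S" if "i \<in> {1..3}" for i
    using measurable_distance_to_prototype[OF that] by (simp add: case_prod_beta)
  have "{z \<in> space ?S. d (snd z) (fst z j) \<le> d (snd z) (fst z i)} \<in> sets ?S"
    if "i \<in> {1..3}" "j \<in> {1..3}" for i j
    using *[OF that(1)] *[OF that(2)] by (intro borel_measurable_le)
  then have mem: "{z \<in> space ?S. i \<in> farthest_set d (fst z) (snd z)} \<in> sets ?S" for i
    unfolding mem_farthest_set_iff
    by (cases "i \<in> {1..3::nat}") (auto intro!: sets.sets_Collect_finite_All simp del: atLeastAtMost_iff)
  have "(\<lambda>z. farthest_set d (fst z) (snd z)) \<in> measurable ?S (count_space (Pow {1..3}))"
  proof (subst measurable_count_space_eq2, simp, intro conjI ballI)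
    show "(\<lambda>z. farthest_set d (fst z) (snd z)) \<in> space ?S \<rightarrow> Pow {1..3}"
      using farthest_set_subset[of d] by (auto simp del: atLeastAtMost_iff)
    fix A :: "nat set" assume A: "A \<in> Pow {1..3}"
    have "(\<lambda>z. farthest_set d (fst z) (snd z)) -` {A} \<inter> space ?S
        = {z \<in> space ?S. \<forall>i\<in>{1..3}. i \<in> farthest_set d (fst z) (snd z) \<longleftrightarrow> i \<in> A}"
      using A farthest_set_subset[of d] by (auto simp: set_eq_iff) blast+
    also have "\<dots> \<in> sets ?S"
      using mem by (intro sets.sets_Collect_finite_All sets.sets_Collect) auto
    finally show "(\<lambda>z. farthest_set d (fst z) (snd z)) -` {A} \<inter> space ?S \<in> sets ?S" .
  qed
  from measurable_compose[OF this, of "\<lambda>A. A" "count_space UNIV"] show ?thesis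
    by (simp add: case_prod_beta)
qed

lemma measurable_farthest_label:
  "(\<lambda>(v, x). pmf (farthest_label d v x) i) \<in> borel_measurable (triple_measure P \<Otimes>\<^sub>M P)"
  using measurable_compose[OF measurable_farthest_set, of "\<lambda>A. pmf (pmf_of_set A) i" borel]
  by (simp add: farthest_label_def case_prod_beta)

lemma cell_prob_eq_integral:
  assumes v: "v \<in> space (triple_measure P)"
  shows "cell_prob P d v i = (\<integral>x. pmf (farthest_label d v x) i \<partial>P)"
proof -
  have "(\<lambda>x. farthest_set d v x) \<in> measurable P (count_space UNIV)"
    using measurable_compose[OF measurable_Pair1'[OF v] measurable_farthest_set] by simp
  from measurable_compose[OF this measurable_measure_pmf[of pmf_of_set]]
  have "(\<lambda>x. measure_pmf (farthest_label d v x)) \<in> measurable P (subprob_algebra (count_space UNIV))"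
    by (simp add: farthest_label_def)
  from subprob_space.measure_bind[OF prob_space_imp_subprob_space[OF prob_space_axioms] this]
  show ?thesis
    by (simp add: cell_prob_def measure_pmf_single)
qed

lemma integrable_pmf_farthest_label:
  assumes v: "v \<in> space (triple_measure P)"
  shows "integrable P (\<lambda>x. pmf (farthest_label d v x) i)"
proof (rule integrable_const_bound[where B = 1])
  show "(\<lambda>x. pmf (farthest_label d v x) i) \<in> borel_measurable P"
    using measurable_compose[OF measurable_Pair1'[OF v] measurable_farthest_label] by simp
qed (simp add: pmf_le_1)

lemma cell_prob_bounds: "cell_prob P d v i \<in> {0..1}" if "v \<in> space (triple_measure P)"
  using integrable_pmf_farthest_label[OF that]
  by (auto simp: cell_prob_eq_integral[OF that] pmf_le_1 intro!: integral_le_const)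

lemma sum_cell_prob:
  assumes v: "v \<in> space (triple_measure P)"
  shows "(\<Sum>i\<in>{1..3}. cell_prob P d v i) = 1"
proof -
  have "(\<Sum>i\<in>{1..3}. cell_prob P d v i) = (\<integral>x. (\<Sum>i\<in>{1..3}. pmf (farthest_label d v x) i) \<partial>P)"
    using integrable_pmf_farthest_label[OF v] by (simp add: cell_prob_eq_integral[OF v])
  then show ?thesis
    unfolding sum_pmf_farthest_label by (simp add: prob_space)
qed

lemma measurable_cell_prob: "(\<lambda>v. cell_prob P d v i) \<in> borel_measurable (triple_measure P)"
proof -
  have "(\<lambda>v. \<integral>x. pmf (farthest_label d v x) i \<partial>P) \<in> borel_measurable (triple_measure P)"
    by (rule borel_measurable_lebesgue_integral[OF measurable_farthest_label])
  then show ?thesis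
    by (simp cong: measurable_cong add: cell_prob_eq_integral)
qed

lemma measurable_cell_entropy:
  "(\<lambda>v. entropy3 (cell_prob P d v)) \<in> borel_measurable (triple_measure P)"
  unfolding entropy3_def
  by (intro borel_measurable_uminus borel_measurable_sum borel_measurable_times
      borel_measurable_ln measurable_cell_prob)

lemma cell_entropy_bounds:
  assumes "v \<in> space (triple_measure P)"
  shows "0 \<le> entropy3 (cell_prob P d v)" "entropy3 (cell_prob P d v) \<le> ln 3"
  using cell_prob_bounds[OF assms] by (auto intro!: entropy3_bounds sum_cell_prob[OF assms])

lemma integrable_cell_entropy: "integrable (triple_measure P) (\<lambda>v. entropy3 (cell_prob P d v))"
proof -
  interpret T: prob_space "triple_measure P" by (rule prob_space_triple_measure)
  show ?thesis
    using cell_entropy_bounds measurable_cell_entropy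
    by (intro T.integrable_const_bound[where B = "ln 3"]) auto
qed

lemma triplet_entropy_bounds: "0 \<le> triplet_entropy P d" "triplet_entropy P d \<le> ln 3"
proof -
  interpret T: prob_space "triple_measure P" by (rule prob_space_triple_measure)
  show "0 \<le> triplet_entropy P d" "triplet_entropy P d \<le> ln 3"
    unfolding triplet_entropy_def
    using cell_entropy_bounds integrable_cell_entropy
    by (auto intro!: integral_nonneg_AE T.integral_le_const)
qed

end

section \<open>Measurability of the sample with respect to its sub-algebras\<close>

locale metric_triplet_sample = base: metric_prob_space P d + triplet_sample P d M N \<Omega> V X L
  for P :: "'a measure" and d :: "'a \<Rightarrow> 'a \<Rightarrow> real" and M N :: nat
    and \<Omega> :: "'w measure"
    and V :: "nat \<Rightarrow> 'w \<Rightarrow> nat \<Rightarrow> 'a" and X :: "nat \<Rightarrow> nat \<Rightarrow> 'w \<Rightarrow> 'a"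
    and L :: "nat \<Rightarrow> nat \<Rightarrow> 'w \<Rightarrow> nat" +
  assumes M_pos: "M \<ge> 1" and N_pos: "N \<ge> 1"
begin

definition index :: "(nat \<times> nat) set" where
  "index = {1..M} \<times> {1..N}"

definition label_prob :: "nat \<times> nat \<Rightarrow> nat \<Rightarrow> 'w \<Rightarrow> real" where
  "label_prob j k \<omega> = pmf (farthest_label d (V (fst j) \<omega>) (X (fst j) (snd j) \<omega>)) k"

abbreviation data :: "'w measure" where
  "data \<equiv> data_algebra P M N \<Omega> V X"

lemma finite_index: "finite index"
  by (simp add: index_def)

lemma measurable_V: "l \<in> {1..M} \<Longrightarrow> V l \<in> measurable \<Omega> (triple_measure P)"
  using prototypes_indep by (simp add: indep_vars_def2 del: atLeastAtMost_iff)

lemma measurable_X: "j \<in> index \<Longrightarrow> X (fst j) (snd j) \<in> measurable \<Omega> P"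
  using witnesses_indep unfolding indep_vars_def2 index_def by (auto simp del: atLeastAtMost_iff)

lemma measurable_prototypes:
  "prototypes M V \<in> measurable \<Omega> (PiM {1..M} (\<lambda>_. triple_measure P))"
  unfolding prototypes_def[abs_def] by (intro measurable_restrict measurable_V)

lemma measurable_witnesses:
  "witnesses M N X \<in> measurable \<Omega> (PiM ({1..M} \<times> {1..N}) (\<lambda>_. P))"
proof -
  have "(\<lambda>\<omega>. \<lambda>j\<in>index. X (fst j) (snd j) \<omega>) \<in> measurable \<Omega> (PiM index (\<lambda>_. P))"
    by (intro measurable_restrict measurable_X)
  then show ?thesis
    by (simp add: witnesses_def[abs_def] index_def case_prod_beta')
qed

text \<open>Independence of prototypes and witnesses is an assumption on the \<open>\<sigma>\<close>-algebras that they
  generate, and a conditional expectation can be tested only against functions measurable for the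
  conditioning algebra. Therefore single prototypes and witnesses are shown to be measurable for
  these smaller algebras.\<close>

lemma measurable_V_wrt_prototypes:
  assumes "l \<in> {1..M}"
  shows "V l \<in> measurable (prototype_algebra P M \<Omega> V) (triple_measure P)"
proof -
  have "prototypes M V \<in> measurable (prototype_algebra P M \<Omega> V) (PiM {1..M} (\<lambda>_. triple_measure P))"
    unfolding prototype_algebra_def
    by (intro measurable_vimage_algebra1 funcsetI measurable_space[OF measurable_prototypes])
  from measurable_compose[OF this measurable_component_singleton[OF assms]]
  show ?thesis
    using assms by (simp add: prototypes_def)
qed

lemma measurable_X_wrt_witnesses:
  assumes "l \<in> {1..M}" "m \<in> {1..N}"
  shows "X l m \<in> measurable (witness_algebra P M N \<Omega> X) P"
proof -
  have "witnesses M N X \<in> measurable (witness_algebra P M N \<Omega> X) (PiM ({1..M} \<times> {1..N}) (\<lambda>_. P))"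
    unfolding witness_algebra_def
    by (intro measurable_vimage_algebra1 funcsetI measurable_space[OF measurable_witnesses])
  from measurable_compose[OF this measurable_component_singleton[of "(l, m)"]]
  show ?thesis
    using assms by (simp add: witnesses_def)
qed

lemma measurable_data:
  "(\<lambda>\<omega>. (prototypes M V \<omega>, witnesses M N X \<omega>))
    \<in> measurable \<Omega> (PiM {1..M} (\<lambda>_. triple_measure P) \<Otimes>\<^sub>M PiM ({1..M} \<times> {1..N}) (\<lambda>_. P))"
  by (intro measurable_Pair measurable_prototypes measurable_witnesses)

lemma subalgebra_data: "subalgebra \<Omega> data"
  unfolding subalgebra_def data_algebra_def
  by (intro conjI sets_image_in_sets measurable_data) auto

lemma measurable_data_map:
  "(\<lambda>\<omega>. (prototypes M V \<omega>, witnesses M N X \<omega>))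
    \<in> measurable data (PiM {1..M} (\<lambda>_. triple_measure P) \<Otimes>\<^sub>M PiM ({1..M} \<times> {1..N}) (\<lambda>_. P))"
  unfolding data_algebra_def
  by (intro measurable_vimage_algebra1 funcsetI measurable_space[OF measurable_data])

lemma measurable_V_wrt_data:
  assumes "l \<in> {1..M}"
  shows "V l \<in> measurable data (triple_measure P)"
  using measurable_compose[OF measurable_compose[OF measurable_data_map measurable_fst]
      measurable_component_singleton[OF assms]] assms
  by (simp add: prototypes_def)

lemma measurable_X_wrt_data:
  assumes "j \<in> index"
  shows "X (fst j) (snd j) \<in> measurable data P"
  using measurable_compose[OF measurable_compose[OF measurable_data_map measurable_snd]
      measurable_component_singleton[OF assms[unfolded index_def]]] assms
  by (simp add: witnesses_def case_prod_beta index_def)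

lemma measurable_label_prob:
  assumes "j \<in> index"
  shows "label_prob j k \<in> borel_measurable data"
proof -
  have "fst j \<in> {1..M}" using assms by (auto simp: index_def)
  from measurable_compose[OF measurable_Pair[OF measurable_V_wrt_data[OF this]
        measurable_X_wrt_data[OF assms]] base.measurable_farthest_label]
  show ?thesis by (simp add: label_prob_def[abs_def])
qed

lemma label_prob_bounds: "0 \<le> label_prob j k \<omega>" "label_prob j k \<omega> \<le> 1"
  by (simp_all add: label_prob_def pmf_le_1)

lemma sum_label_prob: "(\<Sum>k\<in>{1..3}. label_prob j k \<omega>) = 1"
  unfolding label_prob_def by (rule sum_pmf_farthest_label)

lemma measurable_L: "j \<in> index \<Longrightarrow> L (fst j) (snd j) \<in> measurable \<Omega> (count_space UNIV)"
  by (auto simp: index_def intro: labels_measurable)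

lemma events_label: "j \<in> index \<Longrightarrow> {\<omega> \<in> space \<Omega>. L (fst j) (snd j) \<omega> \<in> A} \<in> events"
  using measurable_sets[OF measurable_L, of j A] by (simp add: vimage_def Int_def conj_commute)

section \<open>From the conditional law to moments of label indicators\<close>

text \<open>The assumed conditional law, integrated against a factor \<open>f\<close> that depends only on prototypes and
  witnesses.\<close>

lemma expectation_fixed_labels:
  assumes f: "f \<in> borel_measurable data" and bound: "\<And>\<omega>. \<omega> \<in> space \<Omega> \<Longrightarrow> \<bar>f \<omega>\<bar> \<le> B"
  shows "expectation (\<lambda>\<omega>. f \<omega> * of_bool (\<forall>j\<in>index. L (fst j) (snd j) \<omega> = g j))
    = expectation (\<lambda>\<omega>. f \<omega> * (\<Prod>j\<in>index. label_prob j (g j) \<omega>))"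
proof -
  interpret F: finite_measure_subalgebra \<Omega> data
    by unfold_locales (rule subalgebra_data)
  define E where "E = {\<omega> \<in> space \<Omega>. \<forall>l\<in>{1..M}. \<forall>m\<in>{1..N}. L l m \<omega> = g (l, m)}"
  have E_eq: "E = {\<omega> \<in> space \<Omega>. \<forall>j\<in>index. L (fst j) (snd j) \<omega> \<in> {g j}}"
    by (auto simp: E_def index_def)
  have E: "E \<in> events"
    unfolding E_eq using finite_index by (intro sets.sets_Collect_finite_All events_label)
  have f': "f \<in> borel_measurable \<Omega>"
    by (rule measurable_from_subalg[OF subalgebra_data f])
  have int: "integrable \<Omega> (\<lambda>\<omega>. f \<omega> * indicator E \<omega>)"
    using bound f' E order_trans[OF abs_ge_zero bound]
    by (intro integrable_const_bound[where B = B])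
      (auto simp: indicator_def intro!: AE_I2 borel_measurable_times borel_measurable_indicator)
  have p: "(\<lambda>\<omega>. \<Prod>j\<in>index. label_prob j (g j) \<omega>) \<in> borel_measurable \<Omega>"
    by (intro borel_measurable_prod measurable_from_subalg[OF subalgebra_data] measurable_label_prob)
  have "expectation (\<lambda>\<omega>. f \<omega> * of_bool (\<forall>j\<in>index. L (fst j) (snd j) \<omega> = g j))
      = expectation (\<lambda>\<omega>. f \<omega> * indicator E \<omega>)"
    by (intro Bochner_Integration.integral_cong) (auto simp: E_eq indicator_def)
  also have "\<dots> = expectation (\<lambda>\<omega>. f \<omega> * real_cond_exp \<Omega> data (indicator E) \<omega>)"
    by (rule F.real_cond_exp_intg(2)[symmetric, OF int f]) (use E in simp)
  also have "\<dots> = expectation (\<lambda>\<omega>. f \<omega> * (\<Prod>j\<in>index. label_prob j (g j) \<omega>))"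
  proof (rule integral_cong_AE)
    show "(\<lambda>\<omega>. f \<omega> * real_cond_exp \<Omega> data (indicator E) \<omega>) \<in> borel_measurable \<Omega>"
      using f' by (intro borel_measurable_times) auto
    show "(\<lambda>\<omega>. f \<omega> * (\<Prod>j\<in>index. label_prob j (g j) \<omega>)) \<in> borel_measurable \<Omega>"
      using f' p by (rule borel_measurable_times)
    have prod_eq: "(\<Prod>l\<in>{1..M}. \<Prod>m\<in>{1..N}. pmf (farthest_label d (V l \<omega>) (X l m \<omega>)) (g (l, m)))
        = (\<Prod>j\<in>index. label_prob j (g j) \<omega>)" for \<omega>
      unfolding index_def label_prob_def by (simp add: prod.cartesian_product case_prod_beta)
    show "AE \<omega> in \<Omega>. f \<omega> * real_cond_exp \<Omega> data (indicator E) \<omega>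
        = f \<omega> * (\<Prod>j\<in>index. label_prob j (g j) \<omega>)"
      using labels_law[of "\<lambda>l m. g (l, m)"] unfolding E_def prod_eq by eventually_elim simp
  qed
  finally show ?thesis .
qed

text \<open>A box of label arrays is a finite disjoint union of single arrays. Summing the product law over
  the box and exchanging product and sum leaves the product of the box probabilities: this is
  conditional independence of all the labels.\<close>

lemma expectation_label_box:
  assumes f: "f \<in> borel_measurable data" and bound: "\<And>\<omega>. \<omega> \<in> space \<Omega> \<Longrightarrow> \<bar>f \<omega>\<bar> \<le> B"
    and A: "\<And>j. j \<in> index \<Longrightarrow> finite (A j)"
  shows "expectation (\<lambda>\<omega>. f \<omega> * of_bool (\<forall>j\<in>index. L (fst j) (snd j) \<omega> \<in> A j))
    = expectation (\<lambda>\<omega>. f \<omega> * (\<Prod>j\<in>index. \<Sum>k\<in>A j. label_prob j k \<omega>))"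
proof -
  let ?L = "\<lambda>\<omega>. \<lambda>j\<in>index. L (fst j) (snd j) \<omega>"
  have f': "f \<in> borel_measurable \<Omega>"
    by (rule measurable_from_subalg[OF subalgebra_data f])
  have fin: "finite (PiE index A)"
    using finite_index A by (rule finite_PiE)
  have eq: "(\<forall>j\<in>index. L (fst j) (snd j) \<omega> = g j) \<longleftrightarrow> ?L \<omega> = g" if "g \<in> PiE index A" for g \<omega>
    using PiE_arb[OF that] by (auto simp: fun_eq_iff)
  have split: "of_bool (\<forall>j\<in>index. L (fst j) (snd j) \<omega> \<in> A j)
      = (\<Sum>g\<in>PiE index A. of_bool (\<forall>j\<in>index. L (fst j) (snd j) \<omega> = g j) :: real)" for \<omega>
  proof -
    have "(\<Sum>g\<in>PiE index A. of_bool (\<forall>j\<in>index. L (fst j) (snd j) \<omega> = g j) :: real)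
        = (\<Sum>g\<in>PiE index A. if ?L \<omega> = g then 1 else 0)"
      using eq by (intro sum.cong) auto
    also have "\<dots> = of_bool (?L \<omega> \<in> PiE index A)"
      using fin by simp
    finally show ?thesis
      by (simp add: restrict_PiE_iff Pi_iff)
  qed
  have int: "integrable \<Omega> (\<lambda>\<omega>. f \<omega> * of_bool (\<forall>j\<in>index. L (fst j) (snd j) \<omega> = g j))" for g
  proof (rule integrable_const_bound[where B = B])
    have "{\<omega> \<in> space \<Omega>. \<forall>j\<in>index. L (fst j) (snd j) \<omega> = g j} \<in> events"
      using finite_index events_label[of _ "{g _}"]
      by (intro sets.sets_Collect_finite_All) simp_all
    then have "Measurable.pred \<Omega> (\<lambda>\<omega>. \<forall>j\<in>index. L (fst j) (snd j) \<omega> = g j)"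
      by (simp add: pred_def)
    then show "(\<lambda>\<omega>. f \<omega> * of_bool (\<forall>j\<in>index. L (fst j) (snd j) \<omega> = g j)) \<in> borel_measurable \<Omega>"
      using f' by (intro borel_measurable_times) auto
  qed (use bound order_trans[OF abs_ge_zero bound] in \<open>auto intro!: AE_I2\<close>)
  have int': "integrable \<Omega> (\<lambda>\<omega>. f \<omega> * (\<Prod>j\<in>index. label_prob j (g j) \<omega>))" for g
  proof (rule integrable_const_bound[where B = B])
    show "(\<lambda>\<omega>. f \<omega> * (\<Prod>j\<in>index. label_prob j (g j) \<omega>)) \<in> borel_measurable \<Omega>"
      by (intro borel_measurable_times f' borel_measurable_prod
          measurable_from_subalg[OF subalgebra_data] measurable_label_prob)
    have "\<bar>f \<omega> * (\<Prod>j\<in>index. label_prob j (g j) \<omega>)\<bar> \<le> B * 1" if "\<omega> \<in> space \<Omega>" for \<omega>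
      unfolding abs_mult using bound[OF that] order_trans[OF abs_ge_zero bound[OF that]]
      by (intro mult_mono) (auto simp: label_prob_bounds abs_prod intro!: prod_le_1 prod_nonneg)
    then show "AE \<omega> in \<Omega>. norm (f \<omega> * (\<Prod>j\<in>index. label_prob j (g j) \<omega>)) \<le> B"
      by (intro AE_I2) simp
  qed
  have "expectation (\<lambda>\<omega>. f \<omega> * of_bool (\<forall>j\<in>index. L (fst j) (snd j) \<omega> \<in> A j))
      = (\<Sum>g\<in>PiE index A. expectation (\<lambda>\<omega>. f \<omega> * of_bool (\<forall>j\<in>index. L (fst j) (snd j) \<omega> = g j)))"
    unfolding split sum_distrib_left by (rule Bochner_Integration.integral_sum[OF int])
  also have "\<dots> = (\<Sum>g\<in>PiE index A. expectation (\<lambda>\<omega>. f \<omega> * (\<Prod>j\<in>index. label_prob j (g j) \<omega>)))"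
    by (intro sum.cong refl expectation_fixed_labels[OF f bound])
  also have "\<dots> = expectation (\<lambda>\<omega>. \<Sum>g\<in>PiE index A. f \<omega> * (\<Prod>j\<in>index. label_prob j (g j) \<omega>))"
    by (rule Bochner_Integration.integral_sum[OF int', symmetric])
  also have "\<dots> = expectation (\<lambda>\<omega>. f \<omega> * (\<Prod>j\<in>index. \<Sum>k\<in>A j. label_prob j k \<omega>))"
    using finite_index A
    by (simp add: sum_distrib_left[symmetric] prod_sum_PiE[where f = "\<lambda>j k. label_prob j k _"])
  finally show ?thesis .
qed

text \<open>The box of all arrays with entries in \<open>{1..3}\<close> has conditional probability 1, since each
  factor of the product law sums to 1 over \<open>{1..3}\<close>.\<close>

lemma AE_labels_in_range: "AE \<omega> in \<Omega>. \<forall>j\<in>index. L (fst j) (snd j) \<omega> \<in> {1..3}"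
proof -
  let ?E = "{\<omega> \<in> space \<Omega>. \<forall>j\<in>index. L (fst j) (snd j) \<omega> \<in> {1..3}}"
  have E: "?E \<in> events"
    using finite_index by (intro sets.sets_Collect_finite_All events_label)
  have "prob ?E = expectation (\<lambda>\<omega>. indicator ?E \<omega>)"
    using E by simp
  also have "\<dots> = expectation (\<lambda>\<omega>. 1 * of_bool (\<forall>j\<in>index. L (fst j) (snd j) \<omega> \<in> {1..3}))"
    by (intro Bochner_Integration.integral_cong) (auto simp: indicator_def)
  also have "\<dots> = expectation (\<lambda>\<omega>. 1 * (\<Prod>j\<in>index. \<Sum>k\<in>{1..3}. label_prob j k \<omega>))"
    by (rule expectation_label_box[where B = 1]) auto
  also have "\<dots> = 1"
    unfolding sum_label_prob by (simp add: prob_space)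
  finally have "AE \<omega> in \<Omega>. \<omega> \<in> ?E"
    unfolding AE_in_set_eq_1[OF E] .
  then show ?thesis by eventually_elim simp
qed

text \<open>Marginalization of the conditional law to the evaluations in \<open>J\<close>: up to a null set, leaving an
  evaluation unconstrained means allowing it the box side \<open>{1..3}\<close>, whose conditional probability
  is 1.\<close>

lemma expectation_some_labels:
  assumes f: "f \<in> borel_measurable data" and bound: "\<And>\<omega>. \<omega> \<in> space \<Omega> \<Longrightarrow> \<bar>f \<omega>\<bar> \<le> B"
    and J: "J \<subseteq> index" and i: "i \<in> {1..3}"
  shows "expectation (\<lambda>\<omega>. f \<omega> * (\<Prod>j\<in>J. of_bool (L (fst j) (snd j) \<omega> = i)))
    = expectation (\<lambda>\<omega>. f \<omega> * (\<Prod>j\<in>J. label_prob j i \<omega>))"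
proof -
  have finJ: "finite J" by (rule finite_subset[OF J finite_index])
  have f': "f \<in> borel_measurable \<Omega>"
    by (rule measurable_from_subalg[OF subalgebra_data f])
  define A where "A j = (if j \<in> J then {i} else {1..3})" for j
  have meas: "(\<lambda>\<omega>. of_bool (L (fst j) (snd j) \<omega> \<in> B) :: real) \<in> borel_measurable \<Omega>" if "j \<in> index" for j B
    by (rule measurable_compose[OF measurable_L[OF that]]) simp
  have prod: "of_bool (\<forall>j\<in>index. L (fst j) (snd j) \<omega> \<in> A j)
      = (\<Prod>j\<in>index. of_bool (L (fst j) (snd j) \<omega> \<in> A j) :: real)" for \<omega>
    using finite_index by (auto simp: of_bool_def prod.neutral intro!: prod_zero[symmetric])
  have "expectation (\<lambda>\<omega>. f \<omega> * (\<Prod>j\<in>J. of_bool (L (fst j) (snd j) \<omega> = i)))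
      = expectation (\<lambda>\<omega>. f \<omega> * of_bool (\<forall>j\<in>index. L (fst j) (snd j) \<omega> \<in> A j))"
  proof (rule integral_cong_AE)
    have "(\<lambda>\<omega>. f \<omega> * (\<Prod>j\<in>J. of_bool (L (fst j) (snd j) \<omega> \<in> {i}))) \<in> borel_measurable \<Omega>"
      using J by (intro borel_measurable_times f' borel_measurable_prod meas) auto
    then show "(\<lambda>\<omega>. f \<omega> * (\<Prod>j\<in>J. of_bool (L (fst j) (snd j) \<omega> = i))) \<in> borel_measurable \<Omega>"
      by simp
    show "(\<lambda>\<omega>. f \<omega> * of_bool (\<forall>j\<in>index. L (fst j) (snd j) \<omega> \<in> A j)) \<in> borel_measurable \<Omega>"
      unfolding prod by (intro borel_measurable_times f' borel_measurable_prod meas)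
    show "AE \<omega> in \<Omega>. f \<omega> * (\<Prod>j\<in>J. of_bool (L (fst j) (snd j) \<omega> = i))
        = f \<omega> * of_bool (\<forall>j\<in>index. L (fst j) (snd j) \<omega> \<in> A j)"
      using AE_labels_in_range
    proof eventually_elim
      case (elim \<omega>)
      have "(\<Prod>j\<in>J. of_bool (L (fst j) (snd j) \<omega> = i) :: real)
          = (\<Prod>j\<in>index. of_bool (L (fst j) (snd j) \<omega> \<in> A j))"
        using elim by (intro prod.mono_neutral_cong_left finite_index J) (auto simp: A_def)
      then show ?case by (simp add: prod)
    qed
  qed
  also have "\<dots> = expectation (\<lambda>\<omega>. f \<omega> * (\<Prod>j\<in>index. \<Sum>k\<in>A j. label_prob j k \<omega>))"
    by (rule expectation_label_box[OF f bound]) (auto simp: A_def)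
  also have "(\<lambda>\<omega>. \<Prod>j\<in>index. \<Sum>k\<in>A j. label_prob j k \<omega>) = (\<lambda>\<omega>. \<Prod>j\<in>J. label_prob j i \<omega>)"
    by (intro ext prod.mono_neutral_cong_right finite_index J) (auto simp: A_def sum_label_prob simp del: One_nat_def)
  finally show ?thesis .
qed

section \<open>Mean square errors of frequencies and of the prototype mean\<close>

lemma distr_prototypes_two_witnesses:
  assumes l: "l \<in> {1..M}" and m: "m \<in> {1..N}" "m' \<in> {1..N}" "m \<noteq> m'"
  shows "distr \<Omega> (triple_measure P \<Otimes>\<^sub>M (P \<Otimes>\<^sub>M P)) (\<lambda>\<omega>. (V l \<omega>, X l m \<omega>, X l m' \<omega>))
    = triple_measure P \<Otimes>\<^sub>M (P \<Otimes>\<^sub>M P)"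
proof -
  have "indep_var P (X l m) P (X l m')"
    using indep_var_of_indep_vars[OF witnesses_indep, of "(l, m)" "(l, m')"] l m by simp
  then have XX: "distr \<Omega> (P \<Otimes>\<^sub>M P) (\<lambda>\<omega>. (X l m \<omega>, X l m' \<omega>)) = P \<Otimes>\<^sub>M P"
    unfolding indep_var_distribution_eq using witnesses_law l m by simp
  have meas: "(\<lambda>\<omega>. (X l m \<omega>, X l m' \<omega>)) \<in> measurable (witness_algebra P M N \<Omega> X) (P \<Otimes>\<^sub>M P)"
    using l m by (intro measurable_Pair measurable_X_wrt_witnesses)
  show ?thesis
    using distr_pair_of_indep_set[OF prototypes_witnesses_indep _ _ measurable_V_wrt_prototypes[OF l] meas]
    by (simp add: prototype_algebra_def witness_algebra_def XX prototypes_law[OF l])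
qed

definition centred_label :: "nat \<Rightarrow> nat \<Rightarrow> nat \<Rightarrow> 'w \<Rightarrow> real" where
  "centred_label l i m \<omega> = of_bool (L l m \<omega> = i) - cell_prob P d (V l \<omega>) i"

lemma cell_prob_V_bounds:
  "l \<in> {1..M} \<Longrightarrow> \<omega> \<in> space \<Omega> \<Longrightarrow> cell_prob P d (V l \<omega>) i \<in> {0..1}"
  by (rule base.cell_prob_bounds[OF measurable_space[OF measurable_V]])

lemma measurable_cell_prob_V:
  "l \<in> {1..M} \<Longrightarrow> (\<lambda>\<omega>. cell_prob P d (V l \<omega>) i) \<in> borel_measurable data"
  by (rule measurable_compose[OF measurable_V_wrt_data base.measurable_cell_prob])

text \<open>Two different witnesses are independent of each other and of the triple, so for fixed \<open>v\<close> the
  integral is the square of \<open>\<integral>x. pmf (farthest_label d v x) i - cell_prob P d v i \<partial>P\<close>, which is 0.\<close>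

lemma expectation_centred_label_probs:
  assumes l: "l \<in> {1..M}" and m: "m \<in> {1..N}" "m' \<in> {1..N}" "m \<noteq> m'"
  shows "expectation (\<lambda>\<omega>. (label_prob (l, m) i \<omega> - cell_prob P d (V l \<omega>) i)
    * (label_prob (l, m') i \<omega> - cell_prob P d (V l \<omega>) i)) = 0"
proof -
  let ?T = "triple_measure P"
  let ?dev = "\<lambda>v x. pmf (farthest_label d v x) i - cell_prob P d v i"
  let ?f = "\<lambda>(v, x, x'). ?dev v x * ?dev v x'"
  interpret T: prob_space ?T by (rule base.prob_space_triple_measure)
  interpret PP: pair_prob_space P P ..
  interpret TPP: pair_prob_space ?T "P \<Otimes>\<^sub>M P" ..
  have dev: "(\<lambda>(v, x). ?dev v x) \<in> borel_measurable (?T \<Otimes>\<^sub>M P)"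
    using base.measurable_farthest_label[of i]
      measurable_compose[OF measurable_fst base.measurable_cell_prob[of i], of P]
    by (simp add: case_prod_beta')
  have dev1: "(\<lambda>z. ?dev (fst z) (fst (snd z))) \<in> borel_measurable (?T \<Otimes>\<^sub>M (P \<Otimes>\<^sub>M P))"
    using measurable_compose[OF measurable_Pair[OF measurable_fst
          measurable_compose[OF measurable_snd measurable_fst]] dev, of P] by simp
  have dev2: "(\<lambda>z. ?dev (fst z) (snd (snd z))) \<in> borel_measurable (?T \<Otimes>\<^sub>M (P \<Otimes>\<^sub>M P))"
    using measurable_compose[OF measurable_Pair[OF measurable_fst
          measurable_compose[OF measurable_snd measurable_snd]] dev, of P] by simp
  have f: "?f \<in> borel_measurable (?T \<Otimes>\<^sub>M (P \<Otimes>\<^sub>M P))"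
    using borel_measurable_times[OF dev1 dev2] by (simp add: case_prod_beta')
  have bound: "\<bar>?dev v x * ?dev v x'\<bar> \<le> 1" if "v \<in> space ?T" for v x x'
  proof -
    have "\<bar>?dev v y\<bar> \<le> 1" for y
      using base.cell_prob_bounds[OF that, of i] pmf_nonneg[of "farthest_label d v y" i]
        pmf_le_1[of "farthest_label d v y" i]
      unfolding abs_le_iff atLeastAtMost_iff by linarith
    then show ?thesis
      unfolding abs_mult by (intro mult_le_one) auto
  qed
  have inner: "(\<integral>z. ?f (v, z) \<partial>(P \<Otimes>\<^sub>M P)) = 0" if v: "v \<in> space ?T" for v
  proof -
    have "integrable (P \<Otimes>\<^sub>M P) (\<lambda>z. ?f (v, z))"
      using bound[OF v] measurable_compose[OF measurable_Pair1'[OF v] f]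
      by (intro PP.integrable_const_bound[where B = 1]) auto
    then have "(\<integral>z. ?f (v, z) \<partial>(P \<Otimes>\<^sub>M P)) = (\<integral>x. \<integral>x'. ?dev v x * ?dev v x' \<partial>P \<partial>P)"
      by (subst PP.integral_fst'[symmetric]) simp_all
    also have "(\<lambda>x. \<integral>x'. ?dev v x * ?dev v x' \<partial>P) = (\<lambda>x. ?dev v x * (\<integral>x'. ?dev v x' \<partial>P))"
      by simp
    also have "(\<integral>x'. ?dev v x' \<partial>P) = 0"
      using base.integrable_pmf_farthest_label[OF v, of i]
      by (simp add: base.cell_prob_eq_integral[OF v] base.prob_space)
    finally show ?thesis by simp
  qed
  have "expectation (\<lambda>\<omega>. (label_prob (l, m) i \<omega> - cell_prob P d (V l \<omega>) i)
      * (label_prob (l, m') i \<omega> - cell_prob P d (V l \<omega>) i))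
      = expectation (\<lambda>\<omega>. ?f (V l \<omega>, X l m \<omega>, X l m' \<omega>))"
    by (simp add: label_prob_def)
  also have "\<dots> = (\<integral>z. ?f z \<partial>distr \<Omega> (?T \<Otimes>\<^sub>M (P \<Otimes>\<^sub>M P)) (\<lambda>\<omega>. (V l \<omega>, X l m \<omega>, X l m' \<omega>)))"
    using l m measurable_X[of "(l, m)"] measurable_X[of "(l, m')"]
    by (intro integral_distr[symmetric] f measurable_Pair measurable_V) (auto simp: index_def)
  also have "\<dots> = (\<integral>z. ?f z \<partial>(?T \<Otimes>\<^sub>M (P \<Otimes>\<^sub>M P)))"
    by (simp only: distr_prototypes_two_witnesses[OF assms])
  also have "\<dots> = (\<integral>v. \<integral>z. ?f (v, z) \<partial>(P \<Otimes>\<^sub>M P) \<partial>?T)"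
  proof (rule TPP.integral_fst'[symmetric])
    show "integrable (?T \<Otimes>\<^sub>M (P \<Otimes>\<^sub>M P)) ?f"
      using bound f
      by (intro TPP.integrable_const_bound[where B = 1]) (auto simp: space_pair_measure intro!: AE_I2)
  qed
  also have "\<dots> = (\<integral>v. 0 \<partial>?T)"
    by (intro Bochner_Integration.integral_cong refl inner)
  finally show ?thesis by simp
qed

text \<open>Expanding both products reduces the claim to \<open>expectation_centred_label_probs\<close>: the terms
  with one or two label indicators have the same expectations as those with the corresponding
  conditional probabilities. The two evaluations must differ for the term with two indicators.\<close>

lemma centred_labels_orthogonal:
  assumes l: "l \<in> {1..M}" and m: "m \<in> {1..N}" "m' \<in> {1..N}" "m \<noteq> m'" and i: "i \<in> {1..3}"
  shows "expectation (\<lambda>\<omega>. centred_label l i m \<omega> * centred_label l i m' \<omega>) = 0"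
proof -
  let ?Q = "\<lambda>\<omega>. cell_prob P d (V l \<omega>) i"
  let ?Y = "\<lambda>m \<omega>. of_bool (L l m \<omega> = i) :: real"
  let ?p = "\<lambda>m. label_prob (l, m) i"
  have J: "(l, m) \<in> index" "(l, m') \<in> index" using l m by (auto simp: index_def)
  have Q: "?Q \<in> borel_measurable data" by (rule measurable_cell_prob_V[OF l])
  have Q': "?Q \<in> borel_measurable \<Omega>" by (rule measurable_from_subalg[OF subalgebra_data Q])
  have Q_bound: "\<bar>?Q \<omega>\<bar> \<le> 1" if "\<omega> \<in> space \<Omega>" for \<omega>
    using cell_prob_V_bounds[OF l that, of i] by simp
  have Y: "?Y n \<in> borel_measurable \<Omega>" if "(l, n) \<in> index" for n
    using measurable_compose[OF measurable_L[OF that], of "\<lambda>k. of_bool (k = i)" borel] by simp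
  have p: "?p n \<in> borel_measurable \<Omega>" if "(l, n) \<in> index" for n
    by (rule measurable_from_subalg[OF subalgebra_data measurable_label_prob[OF that]])
  have int: "integrable \<Omega> (\<lambda>\<omega>. f \<omega> * g \<omega>)"
    if "f \<in> borel_measurable \<Omega>" "g \<in> borel_measurable \<Omega>"
      "\<And>\<omega>. \<omega> \<in> space \<Omega> \<Longrightarrow> \<bar>f \<omega>\<bar> \<le> 1" "\<And>\<omega>. \<omega> \<in> space \<Omega> \<Longrightarrow> \<bar>g \<omega>\<bar> \<le> 1" for f g :: "'w \<Rightarrow> real"
    using that by (intro integrable_const_bound[where B = 1])
      (auto simp: abs_mult intro!: AE_I2 mult_le_one borel_measurable_times)
  have single: "expectation (\<lambda>\<omega>. ?Q \<omega> * ?Y n \<omega>) = expectation (\<lambda>\<omega>. ?Q \<omega> * ?p n \<omega>)"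
    if "(l, n) \<in> index" for n
    using expectation_some_labels[OF Q Q_bound, of "{(l, n)}" i] that i by simp
  have double: "expectation (\<lambda>\<omega>. ?Y m \<omega> * ?Y m' \<omega>) = expectation (\<lambda>\<omega>. ?p m \<omega> * ?p m' \<omega>)"
    using expectation_some_labels[of "\<lambda>_. 1" 1 "{(l, m), (l, m')}" i] J m(3) i by simp
  have expand: "expectation (\<lambda>\<omega>. (g m \<omega> - ?Q \<omega>) * (g m' \<omega> - ?Q \<omega>))
      = expectation (\<lambda>\<omega>. g m \<omega> * g m' \<omega>) - expectation (\<lambda>\<omega>. ?Q \<omega> * g m \<omega>)
        - expectation (\<lambda>\<omega>. ?Q \<omega> * g m' \<omega>) + expectation (\<lambda>\<omega>. ?Q \<omega> * ?Q \<omega>)"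
    if g: "\<And>n. (l, n) \<in> index \<Longrightarrow> g n \<in> borel_measurable \<Omega>" "\<And>n \<omega>. \<bar>g n \<omega>\<bar> \<le> 1" for g :: "nat \<Rightarrow> 'w \<Rightarrow> real"
  proof -
    note ints = int[OF g(1)[OF J(1)] g(1)[OF J(2)] g(2) g(2)] int[OF Q' g(1)[OF J(1)] Q_bound g(2)]
      int[OF Q' g(1)[OF J(2)] Q_bound g(2)] int[OF Q' Q' Q_bound Q_bound]
    have "(\<lambda>\<omega>. (g m \<omega> - ?Q \<omega>) * (g m' \<omega> - ?Q \<omega>))
        = (\<lambda>\<omega>. g m \<omega> * g m' \<omega> - ?Q \<omega> * g m \<omega> - ?Q \<omega> * g m' \<omega> + ?Q \<omega> * ?Q \<omega>)"
      by (simp add: algebra_simps)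
    then show ?thesis
      using ints by simp
  qed
  have "expectation (\<lambda>\<omega>. centred_label l i m \<omega> * centred_label l i m' \<omega>)
      = expectation (\<lambda>\<omega>. (?p m \<omega> - ?Q \<omega>) * (?p m' \<omega> - ?Q \<omega>))"
    unfolding centred_label_def
    using expand[of ?Y] expand[of ?p] Y p single[OF J(1)] single[OF J(2)] double
    by (simp add: label_prob_bounds)
  also have "\<dots> = 0"
    by (rule expectation_centred_label_probs[OF l m])
  finally show ?thesis .
qed

lemma label_freq_mean_square_error:
  assumes l: "l \<in> {1..M}" and i: "i \<in> {1..3}"
  shows "integrable \<Omega> (\<lambda>\<omega>. (label_freq N (\<lambda>m. L l m \<omega>) i - cell_prob P d (V l \<omega>) i)\<^sup>2)" (is ?int)
    and "expectation (\<lambda>\<omega>. (label_freq N (\<lambda>m. L l m \<omega>) i - cell_prob P d (V l \<omega>) i)\<^sup>2) \<le> 1 / real N" (is ?le)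
proof -
  have eq: "label_freq N (\<lambda>m. L l m \<omega>) i - cell_prob P d (V l \<omega>) i
      = 1 / real N * (\<Sum>m\<in>{1..N}. centred_label l i m \<omega>)" for \<omega>
    using N_pos by (simp add: label_freq_def centred_label_def sum_subtractf field_simps)
  have meas: "centred_label l i m \<in> borel_measurable \<Omega>" if "m \<in> {1..N}" for m
    using measurable_compose[OF labels_measurable[OF l that], of "\<lambda>k. of_bool (k = i) :: real" borel]
      measurable_from_subalg[OF subalgebra_data measurable_cell_prob_V[OF l, of i]]
    unfolding centred_label_def[abs_def] by (intro borel_measurable_diff) auto
  have bound: "\<bar>centred_label l i m \<omega>\<bar> \<le> 1" if "\<omega> \<in> space \<Omega>" for m \<omega>
    using cell_prob_V_bounds[OF l that, of i] by (auto simp: centred_label_def of_bool_def)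
  note * = mean_square_of_orthogonal_mean[OF N_pos meas bound centred_labels_orthogonal[OF l _ _ _ i]]
  show ?int ?le
    unfolding eq using * by simp_all
qed

lemma prototype_mean_square_error:
  shows "integrable \<Omega> (\<lambda>\<omega>. (1 / real M * (\<Sum>l\<in>{1..M}. entropy3 (cell_prob P d (V l \<omega>)) - triplet_entropy P d))\<^sup>2)" (is ?int)
    and "expectation (\<lambda>\<omega>. (1 / real M * (\<Sum>l\<in>{1..M}. entropy3 (cell_prob P d (V l \<omega>)) - triplet_entropy P d))\<^sup>2)
      \<le> (ln 3)\<^sup>2 / real M" (is ?le)
proof -
  let ?Z = "\<lambda>l \<omega>. entropy3 (cell_prob P d (V l \<omega>)) - triplet_entropy P d"
  have h: "(\<lambda>v. entropy3 (cell_prob P d v) - triplet_entropy P d) \<in> borel_measurable (triple_measure P)"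
    using base.measurable_cell_entropy by simp
  have meas: "?Z l \<in> borel_measurable \<Omega>" if "l \<in> {1..M}" for l
    by (rule measurable_compose[OF measurable_V[OF that] h])
  have bound: "\<bar>?Z l \<omega>\<bar> \<le> ln 3" if "l \<in> {1..M}" "\<omega> \<in> space \<Omega>" for l \<omega>
    using base.cell_entropy_bounds[OF measurable_space[OF measurable_V[OF that(1)] that(2)]]
      base.triplet_entropy_bounds by auto
  have int: "integrable \<Omega> (?Z l)" if "l \<in> {1..M}" for l
    using bound[OF that] meas[OF that] by (intro integrable_const_bound[where B = "ln 3"]) auto
  have mean: "expectation (?Z l) = 0" if l: "l \<in> {1..M}" for l
  proof -
    interpret T: prob_space "triple_measure P" by (rule base.prob_space_triple_measure)
    have "expectation (?Z l)
        = (\<integral>v. entropy3 (cell_prob P d v) - triplet_entropy P d \<partial>distr \<Omega> (triple_measure P) (V l))"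
      by (rule integral_distr[OF measurable_V[OF l] h, symmetric])
    also have "\<dots> = 0"
      using base.integrable_cell_entropy
      by (simp add: prototypes_law[OF l] triplet_entropy_def T.prob_space)
    finally show ?thesis .
  qed
  have indep: "indep_vars (\<lambda>_. borel) ?Z {1..M}"
    by (rule indep_vars_compose2[OF prototypes_indep h])
  have orth: "expectation (\<lambda>\<omega>. ?Z a \<omega> * ?Z b \<omega>) = 0" if "a \<in> {1..M}" "b \<in> {1..M}" "a \<noteq> b" for a b
    using indep_var_lebesgue_integral[OF indep_var_of_indep_vars[OF indep that] int[OF that(1)] int[OF that(2)]]
    by (simp add: mean[OF that(1)])
  show ?int ?le
    using mean_square_of_orthogonal_mean[OF M_pos meas bound orth] by simp_all
qed

end

section \<open>Tail bounds and convergence in probability\<close>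

text \<open>Converts a first moment into a second moment at the price of \<open>\<eta>\<close>.\<close>

lemma abs_le_add_square:
  fixes x :: real
  assumes "\<eta> > 0"
  shows "\<bar>x\<bar> \<le> \<eta> + 1 / \<eta> * x\<^sup>2"
proof (cases "\<bar>x\<bar> \<le> \<eta>")
  case True
  moreover have "0 \<le> 1 / \<eta> * x\<^sup>2" using assms by simp
  ultimately show ?thesis by linarith
next
  case False
  then have "\<eta> * \<bar>x\<bar> \<le> \<bar>x\<bar> * \<bar>x\<bar>" by (intro mult_right_mono) auto
  then have "\<bar>x\<bar> \<le> 1 / \<eta> * x\<^sup>2"
    using assms by (simp add: power2_eq_square pos_le_divide_eq mult.commute)
  then show ?thesis using assms by linarith
qed

lemma mean_deviation_bound:
  fixes e h s :: "nat \<Rightarrow> real"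
  assumes n: "n \<ge> 1" and \<eta>: "\<eta> > 0"
    and e: "\<And>l. l \<in> {1..n} \<Longrightarrow> \<bar>e l - h l\<bar> \<le> \<eta> + c + K * s l"
  shows "\<bar>1 / real n * (\<Sum>l\<in>{1..n}. e l) - H\<bar>
    \<le> 2 * \<eta> + c + K * (1 / real n * (\<Sum>l\<in>{1..n}. s l)) + 1 / \<eta> * (1 / real n * (\<Sum>l\<in>{1..n}. h l - H))\<^sup>2"
proof -
  let ?x = "1 / real n * (\<Sum>l\<in>{1..n}. h l - H)"
  have n0: "real n > 0" using n by simp
  have "\<bar>?x\<bar> \<le> \<eta> + 1 / \<eta> * ?x\<^sup>2"
    by (rule abs_le_add_square[OF \<eta>])
  moreover have "1 / real n * \<bar>\<Sum>l\<in>{1..n}. e l - h l\<bar> \<le> 1 / real n * (\<Sum>l\<in>{1..n}. \<eta> + c + K * s l)"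
    by (intro mult_left_mono order_trans[OF sum_abs] sum_mono e) simp_all
  moreover have "1 / real n * (\<Sum>l\<in>{1..n}. \<eta> + c + K * s l) = \<eta> + c + K * (1 / real n * (\<Sum>l\<in>{1..n}. s l))"
    using n0 by (simp add: sum.distrib sum_distrib_left[symmetric] field_simps)
  moreover have "1 / real n * (\<Sum>l\<in>{1..n}. e l) - H = 1 / real n * (\<Sum>l\<in>{1..n}. e l - h l) + ?x"
    using n0 by (simp add: sum_subtractf field_simps)
  moreover have "\<bar>1 / real n * (\<Sum>l\<in>{1..n}. e l - h l)\<bar> = 1 / real n * \<bar>\<Sum>l\<in>{1..n}. e l - h l\<bar>"
    by (simp add: abs_mult)
  ultimately show ?thesis by linarith
qed

text \<open>Since \<open>min _ (ln 3)\<close> is 1-Lipschitz and fixes \<open>h\<close>, the truncation does not increase the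
  distance to \<open>h\<close>, which stands for the entropy of the true cell vector. The bound \<open>1 / N\<close> holds
  since the support size is between 0 and 3.\<close>

lemma corrected_entropy_perturbation:
  assumes N: "N \<ge> 1" and h: "h \<le> ln 3"
  shows "\<bar>min (x + (real (support_size N y) - 1) / (2 * real N)) (ln 3) - h\<bar> \<le> \<bar>x - h\<bar> + 1 / real N"
proof -
  have "support_size N y \<le> card {1..3::nat}"
    unfolding support_size_def by (intro card_mono) auto
  then have "\<bar>real (support_size N y) - 1\<bar> \<le> 2" by simp
  then have "\<bar>(real (support_size N y) - 1) / (2 * real N)\<bar> \<le> 2 / (2 * real N)"
    unfolding abs_divide using N by (intro frac_le) auto
  then have "\<bar>(real (support_size N y) - 1) / (2 * real N)\<bar> \<le> 1 / real N"
    by simp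
  then show ?thesis using h by linarith
qed

context metric_triplet_sample
begin

text \<open>The summand \<open>e\<close> stands for either the plug-in entropy or the corrected one, whose
  errors exceed that of the plug-in entropy by at most \<open>1 / N\<close>. The bound is uniform in the joint behaviour of \<open>M\<close> and \<open>N\<close>.\<close>

lemma entropy_mean_tail_bound:
  assumes \<eta>: "\<eta> > 0" and K: "K \<ge> 0"
    and modulus: "\<And>p q. \<lbrakk>p \<in> {1..3} \<rightarrow> {0..1}; q \<in> {1..3} \<rightarrow> {0..1}\<rbrakk> \<Longrightarrow>
      \<bar>entropy3 p - entropy3 q\<bar> \<le> \<eta> + K * (\<Sum>i\<in>{1..3}. (p i - q i)\<^sup>2)"
    and e: "\<And>l \<omega>. \<lbrakk>l \<in> {1..M}; \<omega> \<in> space \<Omega>\<rbrakk> \<Longrightarrow>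
      \<bar>e l \<omega> - entropy3 (cell_prob P d (V l \<omega>))\<bar>
        \<le> \<bar>entropy3 (label_freq N (\<lambda>m. L l m \<omega>)) - entropy3 (cell_prob P d (V l \<omega>))\<bar> + 1 / real N"
    and \<epsilon>: "\<epsilon> > 0"
  shows "prob {\<omega> \<in> space \<Omega>. \<bar>1 / real M * (\<Sum>l\<in>{1..M}. e l \<omega>) - triplet_entropy P d\<bar> > \<epsilon>}
    \<le> (2 * \<eta> + (1 + 3 * K) / real N + (ln 3)\<^sup>2 / \<eta> / real M) / \<epsilon>"
proof -
  let ?H = "triplet_entropy P d"
  define h where "h l \<omega> = entropy3 (cell_prob P d (V l \<omega>))" for l \<omega>
  define t where "t l i \<omega> = (label_freq N (\<lambda>m. L l m \<omega>) i - cell_prob P d (V l \<omega>) i)\<^sup>2" for l i \<omega>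
  define u where "u \<omega> = (1 / real M * (\<Sum>l\<in>{1..M}. h l \<omega> - ?H))\<^sup>2" for \<omega>
  define R where "R \<omega> = 2 * \<eta> + 1 / real N + K * (1 / real M * (\<Sum>l\<in>{1..M}. \<Sum>i\<in>{1..3}. t l i \<omega>))
      + 1 / \<eta> * u \<omega>" for \<omega>
  have t_int: "integrable \<Omega> (t l i)" and t_le: "expectation (t l i) \<le> 1 / real N"
    if "l \<in> {1..M}" "i \<in> {1..3}" for l i
    using label_freq_mean_square_error[OF that] by (simp_all add: t_def[abs_def])
  have u_int: "integrable \<Omega> u" and u_le: "expectation u \<le> (ln 3)\<^sup>2 / real M"
    using prototype_mean_square_error by (simp_all add: u_def[abs_def] h_def)
  have ts_int: "integrable \<Omega> (\<lambda>\<omega>. \<Sum>l\<in>{1..M}. \<Sum>i\<in>{1..3}. t l i \<omega>)"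
    by (intro Bochner_Integration.integrable_sum t_int)
  have R_int: "integrable \<Omega> R"
    unfolding R_def[abs_def] using ts_int u_int by simp
  \<comment> \<open>Markov's inequality is applied to this majorant, whose expectation is explicit.\<close>
  have dev: "\<bar>1 / real M * (\<Sum>l\<in>{1..M}. e l \<omega>) - ?H\<bar> \<le> R \<omega>" if \<omega>: "\<omega> \<in> space \<Omega>" for \<omega>
    unfolding R_def u_def
  proof (rule mean_deviation_bound[OF M_pos \<eta>])
    fix l assume l: "l \<in> {1..M}"
    have "\<bar>entropy3 (label_freq N (\<lambda>m. L l m \<omega>)) - h l \<omega>\<bar> \<le> \<eta> + K * (\<Sum>i\<in>{1..3}. t l i \<omega>)"
      unfolding h_def t_def
      by (rule modulus) (use label_freq_in_unit_interval cell_prob_V_bounds[OF l \<omega>] in auto)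
    with e[OF l \<omega>] show "\<bar>e l \<omega> - h l \<omega>\<bar> \<le> \<eta> + 1 / real N + K * (\<Sum>i\<in>{1..3}. t l i \<omega>)"
      unfolding h_def by linarith
  qed
  have "expectation (\<lambda>\<omega>. \<Sum>l\<in>{1..M}. \<Sum>i\<in>{1..3}. t l i \<omega>)
      = (\<Sum>l\<in>{1..M}. \<Sum>i\<in>{1..3}. expectation (t l i))"
    by (subst Bochner_Integration.integral_sum) (intro Bochner_Integration.integrable_sum t_int
        sum.cong refl Bochner_Integration.integral_sum; assumption)+
  also have "\<dots> \<le> (\<Sum>l\<in>{1..M}. \<Sum>i\<in>{1..3::nat}. 1 / real N)"
    by (intro sum_mono t_le)
  finally have ts_le: "1 / real M * expectation (\<lambda>\<omega>. \<Sum>l\<in>{1..M}. \<Sum>i\<in>{1..3}. t l i \<omega>) \<le> 3 / real N"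
    using M_pos by (simp add: field_simps)
  have "prob {\<omega> \<in> space \<Omega>. \<bar>1 / real M * (\<Sum>l\<in>{1..M}. e l \<omega>) - ?H\<bar> > \<epsilon>} \<le> prob {\<omega> \<in> space \<Omega>. R \<omega> \<ge> \<epsilon>}"
  proof (rule finite_measure_mono)
    show "{\<omega> \<in> space \<Omega>. R \<omega> \<ge> \<epsilon>} \<in> events"
      using borel_measurable_integrable[OF R_int] by measurable
  qed (use dev in force)
  also have "\<dots> \<le> expectation R / \<epsilon>"
    using R_int \<epsilon> dev by (intro integral_Markov_inequality_measure[where A = "{}"])
      (auto intro!: AE_I2 order_trans[OF abs_ge_zero])
  also have "expectation R = 2 * \<eta> + 1 / real N
      + K * (1 / real M * expectation (\<lambda>\<omega>. \<Sum>l\<in>{1..M}. \<Sum>i\<in>{1..3}. t l i \<omega>)) + 1 / \<eta> * expectation u"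
    unfolding R_def[abs_def] using ts_int u_int by (simp add: prob_space)
  also have "\<dots> \<le> 2 * \<eta> + 1 / real N + K * (3 / real N) + 1 / \<eta> * ((ln 3)\<^sup>2 / real M)"
    using ts_le u_le K \<eta> by (intro add_mono mult_left_mono) auto
  also have "\<dots> = 2 * \<eta> + (1 + 3 * K) / real N + (ln 3)\<^sup>2 / \<eta> / real M"
    by (simp add: add_divide_distrib)
  finally show ?thesis
    using \<epsilon> by (simp add: divide_right_mono)
qed

end

text \<open>As \<open>A\<close> and \<open>B\<close> may depend on \<open>\<eta>\<close>, first \<open>\<eta>\<close> is fixed, small compared to the tolerance \<open>r * \<epsilon>\<close>,
  and then \<open>M\<close> and \<open>N\<close> tend to infinity.\<close>

lemma tendsto_in_prob_of_tail_bound: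
  fixes Y :: "nat \<Rightarrow> nat \<Rightarrow> 'w \<Rightarrow> real"
  assumes bound: "\<And>\<eta>. \<eta> > 0 \<Longrightarrow> \<exists>A B. \<forall>M\<ge>1. \<forall>N\<ge>1. \<forall>\<epsilon>>0.
    measure (\<Omega> M N) {\<omega> \<in> space (\<Omega> M N). \<bar>Y M N \<omega> - c\<bar> > \<epsilon>} \<le> (2 * \<eta> + A / real N + B / real M) / \<epsilon>"
  shows "tendsto_in_prob (\<lambda>(M, N). \<Omega> M N) (\<lambda>(M, N). Y M N) c (sequentially \<times>\<^sub>F sequentially)"
  unfolding tendsto_in_prob_def
proof (intro allI impI)
  fix \<epsilon> :: real assume \<epsilon>: "\<epsilon> > 0"
  let ?F = "sequentially \<times>\<^sub>F sequentially :: (nat \<times> nat) filter"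
  let ?p = "\<lambda>z. measure (\<Omega> (fst z) (snd z)) {\<omega> \<in> space (\<Omega> (fst z) (snd z)). \<bar>Y (fst z) (snd z) \<omega> - c\<bar> > \<epsilon>}"
  have "(?p \<longlongrightarrow> 0) ?F"
  proof (rule order_tendstoI)
    fix r :: real assume r: "r > 0"
    \<comment> \<open>This leaves half of the tolerance for the terms in \<open>M\<close> and \<open>N\<close>.\<close>
    define \<eta> where "\<eta> = r * \<epsilon> / 4"
    have "\<eta> > 0" using r \<epsilon> by (simp add: \<eta>_def)
    from bound[OF this] obtain A B where "\<forall>M\<ge>1. \<forall>N\<ge>1. \<forall>\<epsilon>>0.
        measure (\<Omega> M N) {\<omega> \<in> space (\<Omega> M N). \<bar>Y M N \<omega> - c\<bar> > \<epsilon>} \<le> (2 * \<eta> + A / real N + B / real M) / \<epsilon>"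
      by (elim exE) (rule that)
    then have AB: "?p z \<le> (2 * \<eta> + A / real (snd z) + B / real (fst z)) / \<epsilon>" if "1 \<le> fst z" "1 \<le> snd z" for z
      using \<epsilon> that by simp
    have fst: "filterlim fst sequentially ?F" and snd: "filterlim snd sequentially ?F"
      by (rule filterlim_fst filterlim_snd)+
    have lim: "(\<lambda>n. C / real n) \<longlonglongrightarrow> 0" for C :: real
      by real_asymp
    have "((\<lambda>z. (2 * \<eta> + A / real (snd z) + B / real (fst z)) / \<epsilon>) \<longlongrightarrow> (2 * \<eta> + 0 + 0) / \<epsilon>) ?F"
      using \<epsilon> by (intro tendsto_intros filterlim_compose[OF lim fst] filterlim_compose[OF lim snd]) simp
    moreover have "(2 * \<eta> + 0 + 0) / \<epsilon> < r"
      using r \<epsilon> by (simp add: \<eta>_def)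
    ultimately have "eventually (\<lambda>z. (2 * \<eta> + A / real (snd z) + B / real (fst z)) / \<epsilon> < r) ?F"
      by (rule order_tendstoD)
    moreover have "eventually (\<lambda>z. 1 \<le> fst z) ?F" "eventually (\<lambda>z. 1 \<le> snd z) ?F"
      by (rule eventually_compose_filterlim[OF eventually_ge_at_top fst]
          eventually_compose_filterlim[OF eventually_ge_at_top snd])+
    ultimately show "eventually (\<lambda>z. ?p z < r) ?F"
      by eventually_elim (rule le_less_trans[OF AB])
  next
    fix r :: real assume "r < 0"
    then show "eventually (\<lambda>z. r < ?p z) ?F"
      by (intro always_eventually allI less_le_trans[OF _ measure_nonneg])
  qed
  then show "((\<lambda>z. measure (case z of (M, N) \<Rightarrow> \<Omega> M N) {\<omega> \<in> space (case z of (M, N) \<Rightarrow> \<Omega> M N).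
      \<bar>(case z of (M, N) \<Rightarrow> Y M N) \<omega> - c\<bar> > \<epsilon>}) \<longlongrightarrow> 0) ?F"
    by (simp add: case_prod_beta)
qed

theorem proposition2:
  fixes P :: "'a measure" and d :: "'a \<Rightarrow> 'a \<Rightarrow> real"
    and \<Omega> :: "nat \<Rightarrow> nat \<Rightarrow> 'w measure"
    and V :: "nat \<Rightarrow> nat \<Rightarrow> nat \<Rightarrow> 'w \<Rightarrow> nat \<Rightarrow> 'a"
    and X :: "nat \<Rightarrow> nat \<Rightarrow> nat \<Rightarrow> nat \<Rightarrow> 'w \<Rightarrow> 'a"
    and L :: "nat \<Rightarrow> nat \<Rightarrow> nat \<Rightarrow> nat \<Rightarrow> 'w \<Rightarrow> nat"
  assumes "metric_prob_space P d"
    and "\<And>M N. M \<ge> 1 \<Longrightarrow> N \<ge> 1 \<Longrightarrow>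
           triplet_sample P d M N (\<Omega> M N) (V M N) (X M N) (L M N)"
  shows "tendsto_in_prob (\<lambda>(M, N). \<Omega> M N)
           (\<lambda>(M, N) \<omega>. entropy_estimator M N (\<lambda>l m. L M N l m \<omega>))
           (triplet_entropy P d) (sequentially \<times>\<^sub>F sequentially)
       \<and> tendsto_in_prob (\<lambda>(M, N). \<Omega> M N)
           (\<lambda>(M, N) \<omega>. corrected_entropy_estimator M N (\<lambda>l m. L M N l m \<omega>))
           (triplet_entropy P d) (sequentially \<times>\<^sub>F sequentially)"
proof -
  have sample: "metric_triplet_sample P d M N (\<Omega> M N) (V M N) (X M N) (L M N)"
    if "M \<ge> 1" "N \<ge> 1" for M N
    using assms(1) assms(2)[OF that] that
    by (simp add: metric_triplet_sample_def metric_triplet_sample_axioms_def)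
  have tail: "\<exists>A B. \<forall>M\<ge>1. \<forall>N\<ge>1. \<forall>\<epsilon>>0.
      measure (\<Omega> M N) {\<omega> \<in> space (\<Omega> M N). \<bar>1 / real M * (\<Sum>l\<in>{1..M}. e M N l \<omega>) - triplet_entropy P d\<bar> > \<epsilon>}
        \<le> (2 * \<eta> + A / real N + B / real M) / \<epsilon>"
    if \<eta>: "\<eta> > 0" and e: "\<And>M N l \<omega>. \<lbrakk>M \<ge> 1; N \<ge> 1; l \<in> {1..M}; \<omega> \<in> space (\<Omega> M N)\<rbrakk> \<Longrightarrow>
      \<bar>e M N l \<omega> - entropy3 (cell_prob P d (V M N l \<omega>))\<bar>
        \<le> \<bar>entropy3 (label_freq N (\<lambda>m. L M N l m \<omega>)) - entropy3 (cell_prob P d (V M N l \<omega>))\<bar> + 1 / real N"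
    for e :: "nat \<Rightarrow> nat \<Rightarrow> nat \<Rightarrow> 'w \<Rightarrow> real" and \<eta>
  proof -
    obtain K where K: "K \<ge> 0" "\<And>p q. \<lbrakk>p \<in> {1..3} \<rightarrow> {0..1}; q \<in> {1..3} \<rightarrow> {0..1}\<rbrakk> \<Longrightarrow>
        \<bar>entropy3 p - entropy3 q\<bar> \<le> \<eta> + K * (\<Sum>i\<in>{1..3}. (p i - q i)\<^sup>2)"
      using entropy3_modulus[OF \<eta>] by blast
    have "measure (\<Omega> M N) {\<omega> \<in> space (\<Omega> M N). \<bar>1 / real M * (\<Sum>l\<in>{1..M}. e M N l \<omega>) - triplet_entropy P d\<bar> > \<epsilon>}
        \<le> (2 * \<eta> + (1 + 3 * K) / real N + (ln 3)\<^sup>2 / \<eta> / real M) / \<epsilon>"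
      if "M \<ge> 1" "N \<ge> 1" "\<epsilon> > 0" for M N \<epsilon>
      by (rule metric_triplet_sample.entropy_mean_tail_bound[OF sample[OF that(1,2)] \<eta> K e[OF that(1,2)] that(3)])
    then show ?thesis by blast
  qed
  have entropy_le: "entropy3 (cell_prob P d (V M N l \<omega>)) \<le> ln 3"
    if "M \<ge> 1" "N \<ge> 1" "l \<in> {1..M}" "\<omega> \<in> space (\<Omega> M N)" for M N l \<omega>
    using metric_prob_space.cell_entropy_bounds(2)[OF assms(1)
        measurable_space[OF metric_triplet_sample.measurable_V[OF sample[OF that(1,2)] that(3)] that(4)]] .
  have "tendsto_in_prob (\<lambda>(M, N). \<Omega> M N)
      (\<lambda>(M, N). \<lambda>\<omega>. entropy_estimator M N (\<lambda>l m. L M N l m \<omega>))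
      (triplet_entropy P d) (sequentially \<times>\<^sub>F sequentially)"
    unfolding entropy_estimator_def
    by (rule tendsto_in_prob_of_tail_bound, rule tail) auto
  moreover have "tendsto_in_prob (\<lambda>(M, N). \<Omega> M N)
      (\<lambda>(M, N). \<lambda>\<omega>. corrected_entropy_estimator M N (\<lambda>l m. L M N l m \<omega>))
      (triplet_entropy P d) (sequentially \<times>\<^sub>F sequentially)"
    unfolding corrected_entropy_estimator_def
    by (rule tendsto_in_prob_of_tail_bound, rule tail)
      (auto intro!: corrected_entropy_perturbation entropy_le)
  ultimately show ?thesis by simp
qed

end
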